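(* Let $l,m\ge 0$ be integers, let $p\in\mathscr{P}_l$ and $q\in\mathscr{H}_{\kappa,m}$. If $l-m=2n$ is a non-negative even integer, then \[ \frac{1}{\omega_{\kappa,d}}\int_{S^{d-1}} q(y)\,p(y)\,h_\kappa^2(y)\,d\sigma(y)=\frac{1}{2^{m+2n}\,n!\,(\lambda_\kappa+1)_{m+n}}\;q(\mathscr{D})\Delta_\kappa^{n}p \] (the right-hand side being a constant since $q(\mathscr{D})\Delta_\kappa^n p$ is a polynomial of degree $0$). If $l-m$ is negative or odd, the integral on the left-hand side vanishes.
   Context: Let $d\ge1$, $\langle\cdot,\cdot\rangle$ the standard inner product on $\mathbb{R}^d$, $\|x\|=\langle x,x\rangle^{1/2}$. Let $R\subset\mathbb{R}^d$ be a reduced root system (not necessarily crystallographic) with a fixed positive system $R_+$, $r_\alpha$ the reflection in $\alpha^\perp$, and $G$ the finite reflection group generated by the $r_\alpha$. Let $\kappa:R\to\mathbb{R}_{\ge0}$, $\alpha\mapsto\kappa_\alpha$, be $G$-invariant (a multiplicity function). Put $\lambda_\kappa=\frac d2-1+\sum_{\alpha\in R_+}\kappa_\alpha$. For $\xi\in\mathbb{R}^d\setminus\{0\}$ the Dunkl operator is $\mathscr{D}_\xi f(x)=\partial_\xi f(x)+\sum_{\alpha\in R_+}\kappa_\alpha\langle\alpha,\xi\rangle\frac{f(x)-f(r_\alpha x)}{\langle\alpha,x\rangle}$, where $\partial_\xi$ is the directional derivative; these operators commute. With $e_1,\dots,e_d$ the standard basis, $\mathscr{D}_j=\mathscr{D}_{e_j}$,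 $\mathscr{D}=(\mathscr{D}_1,\dots,\mathscr{D}_d)$, and $\Delta_\kappa=\sum_j\mathscr{D}_j^2$ (Dunkl Laplacian). For a polynomial $q$, $q(\mathscr{D})$ is obtained by substituting $\mathscr{D}_j$ for $x_j$. $\mathscr{P}$ denotes real polynomials on $\mathbb{R}^d$, $\mathscr{P}_m$ the homogeneous ones of degree $m$, $\mathscr{H}_{\kappa,m}=\{p\in\mathscr{P}_m:\Delta_\kappa p=0\}$. The weight is $h_\kappa(x)=\prod_{\alpha\in R_+}|\langle\alpha,x\rangle|^{\kappa_\alpha}$, $d\sigma$ is surface measure on the unit sphere $S^{d-1}$, and $\omega_{\kappa,d}=\int_{S^{d-1}}h_\kappa^2\,d\sigma$. $(a)_0=1$, $(a)_n=a(a+1)\cdots(a+n-1)$. *)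

theory Defs
  imports "HOL-Analysis.Analysis" "HOL-Library.Poly_Mapping"
begin

(* Space R^d is real^'n, d = CARD('n); the linorder on 'n only fixes an order
   in which the (commuting) Dunkl operators are composed in q(D). *)

definition refl :: "real^'n \<Rightarrow> real^'n \<Rightarrow> real^'n" where
  "refl \<alpha> x = x - (2 * (\<alpha> \<bullet> x) / (\<alpha> \<bullet> \<alpha>)) *\<^sub>R \<alpha>"

definition root_system :: "(real^'n) set \<Rightarrow> bool" where
  "root_system R \<longleftrightarrow> finite R \<and> 0 \<notin> R \<and>
     (\<forall>\<alpha>\<in>R. refl \<alpha> ` R = R) \<and>
     (\<forall>\<alpha>\<in>R. \<forall>c::real. c *\<^sub>R \<alpha> \<in> R \<longleftrightarrow> c = 1 \<or> c = -1)"

definition positive_system :: "(real^'n) set \<Rightarrow> (real^'n) set \<Rightarrow> bool" where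
  "positive_system R Rp \<longleftrightarrow>
     (\<exists>v. (\<forall>\<alpha>\<in>R. \<alpha> \<bullet> v \<noteq> 0) \<and> Rp = {\<alpha>\<in>R. \<alpha> \<bullet> v > 0})"

inductive_set refl_group :: "(real^'n) set \<Rightarrow> (real^'n \<Rightarrow> real^'n) set"
  for R :: "(real^'n) set" where
  id: "id \<in> refl_group R"
| step: "g \<in> refl_group R \<Longrightarrow> \<alpha> \<in> R \<Longrightarrow> refl \<alpha> \<circ> g \<in> refl_group R"

definition multiplicity :: "(real^'n) set \<Rightarrow> (real^'n \<Rightarrow> real) \<Rightarrow> bool" where
  "multiplicity R \<kappa> \<longleftrightarrow> (\<forall>\<alpha>\<in>R. \<kappa> \<alpha> \<ge> 0) \<and>
     (\<forall>g\<in>refl_group R. \<forall>\<alpha>\<in>R. \<kappa> (g \<alpha>) = \<kappa> \<alpha>)"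

definition lambda_kappa :: "(real^'n) set \<Rightarrow> (real^'n \<Rightarrow> real) \<Rightarrow> real" where
  "lambda_kappa Rp \<kappa> = real CARD('n) / 2 - 1 + (\<Sum>\<alpha>\<in>Rp. \<kappa> \<alpha>)"

definition ddir :: "real^'n \<Rightarrow> (real^'n \<Rightarrow> real) \<Rightarrow> real^'n \<Rightarrow> real" where
  "ddir \<xi> f x = deriv (\<lambda>t. f (x + t *\<^sub>R \<xi>)) 0"

(* Dunkl operator; on the hyperplane <alpha,x> = 0 the difference quotient is
   replaced by its continuous extension 2 d_alpha f(x)/|alpha|^2 (exact for polynomials) *)
definition dunkl :: "(real^'n) set \<Rightarrow> (real^'n \<Rightarrow> real) \<Rightarrow> real^'n \<Rightarrow> (real^'n \<Rightarrow> real) \<Rightarrow> real^'n \<Rightarrow> real" where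
  "dunkl Rp \<kappa> \<xi> f x = ddir \<xi> f x +
     (\<Sum>\<alpha>\<in>Rp. \<kappa> \<alpha> * (\<alpha> \<bullet> \<xi>) *
        (if \<alpha> \<bullet> x = 0 then 2 * ddir \<alpha> f x / (\<alpha> \<bullet> \<alpha>)
         else (f x - f (refl \<alpha> x)) / (\<alpha> \<bullet> x)))"

definition dunkl_j :: "(real^'n) set \<Rightarrow> (real^'n \<Rightarrow> real) \<Rightarrow> 'n \<Rightarrow> (real^'n \<Rightarrow> real) \<Rightarrow> real^'n \<Rightarrow> real" where
  "dunkl_j Rp \<kappa> j = dunkl Rp \<kappa> (axis j 1)"

definition dunkl_laplacian :: "(real^'n) set \<Rightarrow> (real^'n \<Rightarrow> real) \<Rightarrow> (real^'n \<Rightarrow> real) \<Rightarrow> real^'n \<Rightarrow> real" where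
  "dunkl_laplacian Rp \<kappa> f x = (\<Sum>j\<in>UNIV. dunkl_j Rp \<kappa> j (dunkl_j Rp \<kappa> j f) x)"

type_synonym 'n rpoly = "('n \<Rightarrow>\<^sub>0 nat) \<Rightarrow>\<^sub>0 real"

definition rpoly_eval :: "('n::finite) rpoly \<Rightarrow> real^'n \<Rightarrow> real" where
  "rpoly_eval P x = (\<Sum>a\<in>Poly_Mapping.keys P. Poly_Mapping.lookup P a * (\<Prod>i\<in>UNIV. (x $ i) ^ Poly_Mapping.lookup a i))"

definition hom_polys :: "nat \<Rightarrow> ('n::finite) rpoly set" where
  "hom_polys l = {P. \<forall>a\<in>Poly_Mapping.keys P. (\<Sum>i\<in>UNIV. Poly_Mapping.lookup a i) = l}"

definition dunkl_harmonics :: "(real^('n::finite)) set \<Rightarrow> (real^'n \<Rightarrow> real) \<Rightarrow> nat \<Rightarrow> 'n rpoly set" where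
  "dunkl_harmonics Rp \<kappa> m =
     {P \<in> hom_polys m. \<forall>x. dunkl_laplacian Rp \<kappa> (rpoly_eval P) x = 0}"

(* D^a = D_1^{a_1} ... D_d^{a_d} (the D_j commute) *)
definition dunkl_mono :: "(real^('n::{finite,linorder})) set \<Rightarrow> (real^('n::{finite,linorder}) \<Rightarrow> real) \<Rightarrow> ('n::{finite,linorder} \<Rightarrow>\<^sub>0 nat)
      \<Rightarrow> (real^('n::{finite,linorder}) \<Rightarrow> real) \<Rightarrow> real^('n::{finite,linorder}) \<Rightarrow> real" where
  "dunkl_mono Rp \<kappa> a f =
     foldr (\<lambda>i g. (dunkl_j Rp \<kappa> i ^^ Poly_Mapping.lookup a i) g) (sorted_list_of_set UNIV) f"

definition poly_dunkl :: "(real^('n::{finite,linorder})) set \<Rightarrow> (real^('n::{finite,linorder}) \<Rightarrow> real) \<Rightarrow> ('n::{finite,linorder}) rpoly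
      \<Rightarrow> (real^('n::{finite,linorder}) \<Rightarrow> real) \<Rightarrow> real^('n::{finite,linorder}) \<Rightarrow> real" where
  "poly_dunkl Rp \<kappa> Q f x = (\<Sum>a\<in>Poly_Mapping.keys Q. Poly_Mapping.lookup Q a * dunkl_mono Rp \<kappa> a f x)"

(* 0^0 = 1 convention made explicit since 0 powr 0 = 0 in Isabelle *)
definition h_kappa :: "(real^'n) set \<Rightarrow> (real^'n \<Rightarrow> real) \<Rightarrow> real^'n \<Rightarrow> real" where
  "h_kappa Rp \<kappa> x = (\<Prod>\<alpha>\<in>Rp. if \<kappa> \<alpha> = 0 then 1 else \<bar>\<alpha> \<bullet> x\<bar> powr \<kappa> \<alpha>)"

(* surface measure on S^{d-1}, via the cone construction:
   sigma(A) = d * lambda({t x | x in A, 0 < t <= 1}) *)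
definition sphere_measure :: "(real^'n) measure" where
  "sphere_measure = measure_of (sphere 0 1) (sets (restrict_space borel (sphere 0 1)))
     (\<lambda>A. ennreal (real CARD('n)) * emeasure lborel {t *\<^sub>R x | t x. x \<in> A \<and> 0 < t \<and> t \<le> 1})"

definition omega_kappa :: "(real^'n) set \<Rightarrow> (real^'n \<Rightarrow> real) \<Rightarrow> real" where
  "omega_kappa Rp \<kappa> = integral\<^sup>L sphere_measure (\<lambda>y. (h_kappa Rp \<kappa> y)\<^sup>2)"

end

theory Submission
  imports Defs
begin

text \<open>
  Write \<open>I(f)\<close> for the integral of \<open>f h\<^sub>\<kappa>\<^sup>2\<close> over the sphere. The only analytic input is
  \<open>I(D\<^sub>\<xi> f) = (l - 1 + d + 2\<gamma>) I(\<langle>\<xi>,x\<rangle> f)\<close> for \<open>f\<close> homogeneous of degree \<open>l\<close>, where \<open>\<gamma> = \<Sum>\<kappa>\<^sub>\<alpha>\<close>; it comes from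
  integrating a directional derivative over the ball against a smoothed weight and symmetrising
  under the reflections. It yields Green's formula
  \<open>I(\<Delta>f q) = (l + m + 2\<lambda>)(l - m) I(f q)\<close> for harmonic \<open>q\<close> of degree \<open>m\<close>, hence orthogonality for \<open>l < m\<close>
  and the reduction of \<open>l = m + 2n\<close> to \<open>l = m\<close>. For \<open>l = m\<close>, the commutation rule \<open>[\<Delta>, x\<^sub>j] = 2 D\<^sub>j\<close> shows
  that the \<open>m\<close>-fold commutator of \<open>\<Delta>\<close> with multiplication by \<open>q\<close> is \<open>2\<^sup>m m! q(D)\<close>; integrating it
  against \<open>f\<close>, only the term \<open>\<Delta>\<^sup>m(q f)\<close> survives by orthogonality, and \<open>I(\<Delta>F)\<close> is a multiple of \<open>I(F)\<close>.
\<close>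

section \<open>Homogeneous polynomial functions and reflections\<close>

text \<open>Operators built from \<open>deriv\<close> and pointwise quotients need not obey the
  usual rules on arbitrary functions, so polynomials are treated as functions generated by
  constants, sums and coordinate multiplications. Induction over \<open>hpoly\<close> reduces an
  operator identity to the commutator with one coordinate; linearity in the direction, equivariance
  and commutativity all arise in this way. Two obstacles shape the analysis. The weight need not be
  differentiable on the root hyperplanes when a multiplicity is small, hence the smoothing. The
  surface measure is given only through cones, hence the ball: a cut-off vanishing on its boundary
  removes boundary terms, and homogeneity turns each ball integral into a multiple of a sphere
  integral. The constant comes from two telescoping products: the m commutator steps give 4^m m!
  (lambda + 1)_m, to be divided by 2^m m!, and the n Green steps give 4^n n! (lambda + 1 + m)_n; the
  two Pochhammer symbols join to (lambda + 1)_(m+n).\<close>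

inductive hpoly :: "nat \<Rightarrow> (real^'n \<Rightarrow> real) \<Rightarrow> bool" where
  const: "hpoly 0 (\<lambda>x. c)"
| mult: "hpoly l f \<Longrightarrow> hpoly (Suc l) (\<lambda>x. x $ j * f x)"
| add: "hpoly l f \<Longrightarrow> hpoly l g \<Longrightarrow> hpoly l (\<lambda>x. f x + g x)"

lemma hpoly_cmult: "hpoly l f \<Longrightarrow> hpoly l (\<lambda>x. c * f x)"
proof (induction rule: hpoly.induct)
  case (mult l f j)
  have "(\<lambda>x. c * (x $ j * f x)) = (\<lambda>x. x $ j * (c * f x))" by (auto simp: algebra_simps)
  with hpoly.mult[OF mult.IH, of j] show ?case by simp
qed (auto simp: distrib_left intro: hpoly.intros)

text \<open>Zero has every degree; this is what makes truncated degrees such as \<open>l - 1\<close>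
  and \<open>l - 2\<close> harmless later.\<close>

lemma hpoly_zero: "hpoly l (\<lambda>x. 0)"
proof (induction l)
  case (Suc l)
  from hpoly.mult[OF this, of undefined] show ?case by simp
qed (rule hpoly.const)

lemma hpoly_diff: "hpoly l f \<Longrightarrow> hpoly l g \<Longrightarrow> hpoly l (\<lambda>x. f x - g x)"
  using hpoly.add[OF _ hpoly_cmult[where c = "-1"], of l f g] by simp

lemma hpoly_sum: "(\<And>i. i \<in> A \<Longrightarrow> hpoly l (f i)) \<Longrightarrow> hpoly l (\<lambda>x. \<Sum>i\<in>A. f i x)"
  by (induction A rule: infinite_finite_induct) (auto intro: hpoly_zero hpoly.add)

lemma hpoly_inner_mult:
  assumes "hpoly l f"
  shows "hpoly (Suc l) (\<lambda>x. (\<eta> \<bullet> x) * f x)"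
proof -
  have "(\<lambda>x. (\<eta> \<bullet> x) * f x) = (\<lambda>x. \<Sum>j\<in>UNIV. \<eta> $ j * (x $ j * f x))"
    by (auto simp: inner_vec_def sum_distrib_right mult.assoc)
  then show ?thesis using assms by (auto intro!: hpoly_sum hpoly_cmult hpoly.mult)
qed

lemma hpoly_mult: "hpoly a f \<Longrightarrow> hpoly b g \<Longrightarrow> hpoly (a + b) (\<lambda>x. f x * g x)"
proof (induction rule: hpoly.induct)
  case (mult l f j)
  from hpoly.mult[OF mult.IH[OF mult.prems], of j] show ?case by (simp add: mult.assoc)
qed (auto simp: distrib_right intro: hpoly_cmult hpoly.add)

lemma hpoly_coord_power: "hpoly a q \<Longrightarrow> hpoly (k + a) (\<lambda>x. (x $ j) ^ k * q x)"
proof (induction k)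
  case (Suc k)
  from hpoly.mult[OF Suc.IH[OF Suc.prems], of j] show ?case by (simp add: mult.assoc)
qed simp

lemma hpoly_monomial_list: "hpoly (\<Sum>i\<leftarrow>xs. a i) (\<lambda>x. \<Prod>i\<leftarrow>xs. (x $ i) ^ a i)"
  by (induction xs) (auto intro: hpoly.const hpoly_coord_power)

lemma hpoly_norm_sq: 
  assumes "hpoly l f" shows "hpoly (l + 2) (\<lambda>x. (x \<bullet> x) * f x)"
proof -
  have "(\<lambda>x. (x \<bullet> x) * f x) = (\<lambda>x. \<Sum>j\<in>UNIV. x $ j * (x $ j * f x))"
    by (auto simp: inner_vec_def sum_distrib_right mult.assoc)
  moreover have "hpoly (Suc (Suc l)) (\<lambda>x. \<Sum>j\<in>UNIV. x $ j * (x $ j * f x))"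
    by (intro hpoly_sum hpoly.mult assms)
  ultimately show ?thesis by simp
qed

lemma hpoly_scale: "hpoly l f \<Longrightarrow> f (t *\<^sub>R x) = t ^ l * f x"
  by (induction rule: hpoly.induct) (auto simp: algebra_simps)

lemma hpoly_minus: "hpoly l f \<Longrightarrow> f (- x) = (- 1) ^ l * f x"
  using hpoly_scale[of l f "-1" x] by simp

lemma hpoly_continuous: "hpoly l f \<Longrightarrow> continuous_on UNIV f"
  by (induction rule: hpoly.induct) (auto intro!: continuous_intros)

lemma hpoly_line_differentiable: "hpoly l f \<Longrightarrow> (\<lambda>t. f (x + t *\<^sub>R \<xi>)) field_differentiable at t"
  by (induction rule: hpoly.induct) (auto intro!: derivative_intros simp: field_differentiable_add)

lemma DERIV_hpoly_line: "hpoly l f \<Longrightarrow> ((\<lambda>t. f (x + t *\<^sub>R \<xi>)) has_field_derivative ddir \<xi> f x) (at 0)"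
  unfolding ddir_def using hpoly_line_differentiable field_differentiable_derivI by blast

lemma hpoly_0E:
  assumes "hpoly 0 f" obtains c where "f = (\<lambda>x. c)"
proof -
  have "hpoly l f \<Longrightarrow> l = 0 \<Longrightarrow> \<exists>c. f = (\<lambda>x. c)" for l
    by (induction rule: hpoly.induct) auto
  with assms that show thesis by blast
qed

section \<open>Reflections as linear isometries\<close>

lemma inner_refl: "\<alpha> \<noteq> 0 \<Longrightarrow> refl \<alpha> x \<bullet> refl \<alpha> y = x \<bullet> y"
  by (simp add: refl_def inner_diff_left inner_diff_right inner_commute[of x \<alpha>] field_simps)

lemma refl_refl: "\<alpha> \<noteq> 0 \<Longrightarrow> refl \<alpha> (refl \<alpha> x) = x"
  by (simp add: refl_def inner_diff_right field_simps flip: scaleR_add_left)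

lemma refl_self: "\<alpha> \<noteq> 0 \<Longrightarrow> refl \<alpha> \<alpha> = - \<alpha>"
  by (simp add: refl_def scaleR_2)

lemma refl_minus: "refl (- \<alpha>) = refl \<alpha>" "refl \<alpha> (- x) = - refl \<alpha> x"
  by (auto simp: refl_def fun_eq_iff)

lemma inner_refl_swap: "\<alpha> \<noteq> 0 \<Longrightarrow> refl \<alpha> x \<bullet> y = x \<bullet> refl \<alpha> y"
  using inner_refl[of \<alpha> x "refl \<alpha> y"] by (simp add: refl_refl)

lemma refl_fixed: "\<alpha> \<bullet> x = 0 \<Longrightarrow> refl \<alpha> x = x"
  by (simp add: refl_def)

lemma linear_refl: "linear (refl \<alpha>)"
  by (rule linearI) (auto simp: refl_def inner_add_right algebra_simps add_divide_distrib)

text \<open>Conjugating a reflection by a linear isometry only moves its root. Equivariance of the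
  Dunkl operators rests on this.\<close>

lemma refl_conj: "\<beta> \<noteq> 0 \<Longrightarrow> refl \<beta> (refl (refl \<beta> \<alpha>) x) = refl \<alpha> (refl \<beta> x)"
proof -
  assume b: "\<beta> \<noteq> 0"
  interpret linear "refl \<beta>" by (rule linear_refl)
  show ?thesis
    unfolding refl_def[of "refl \<beta> \<alpha>"] diff scaleR
    by (simp add: refl_refl b inner_refl inner_refl_swap) (simp add: refl_def)
qed

lemma hpoly_refl:
  fixes f :: "real^'n \<Rightarrow> real"
  shows "hpoly l f \<Longrightarrow> hpoly l (\<lambda>x. f (refl \<alpha> x))"
proof (induction rule: hpoly.induct)
  case (mult l f j)
  define \<eta> :: "real^'n" where "\<eta> = axis j 1 - (2 * \<alpha> $ j / (\<alpha> \<bullet> \<alpha>)) *\<^sub>R \<alpha>"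
  have "refl \<alpha> x $ j = \<eta> \<bullet> x" for x
    by (simp add: refl_def \<eta>_def inner_diff_left inner_axis' )
  with hpoly_inner_mult[OF mult.IH, of \<eta>] show ?case by simp
qed (auto intro: hpoly.intros)

section \<open>Divided differences and directional derivatives\<close>

definition diffquot :: "real^'n \<Rightarrow> (real^'n \<Rightarrow> real) \<Rightarrow> real^'n \<Rightarrow> real" where
  "diffquot \<alpha> f x = (if \<alpha> \<bullet> x = 0 then 2 * ddir \<alpha> f x / (\<alpha> \<bullet> \<alpha>) else (f x - f (refl \<alpha> x)) / (\<alpha> \<bullet> x))"

lemma ddir_const: "ddir \<xi> (\<lambda>x. c) = (\<lambda>x. 0)"
  by (simp add: ddir_def fun_eq_iff)

lemma ddir_add:
  assumes "hpoly l f" "hpoly k g"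
  shows "ddir \<xi> (\<lambda>x. f x + g x) = (\<lambda>x. ddir \<xi> f x + ddir \<xi> g x)"
proof
  fix x
  show "ddir \<xi> (\<lambda>x. f x + g x) x = ddir \<xi> f x + ddir \<xi> g x"
    unfolding ddir_def[of _ "\<lambda>x. f x + g x"]
    using DERIV_add[OF DERIV_hpoly_line[OF assms(1)] DERIV_hpoly_line[OF assms(2)]] by (rule DERIV_imp_deriv)
qed

lemma ddir_mult:
  assumes "hpoly l f" "hpoly k g"
  shows "ddir \<xi> (\<lambda>x. f x * g x) = (\<lambda>x. ddir \<xi> f x * g x + f x * ddir \<xi> g x)"
proof
  fix x
  have "((\<lambda>t. f (x + t *\<^sub>R \<xi>) * g (x + t *\<^sub>R \<xi>)) has_real_derivative ddir \<xi> f x * g x + f x * ddir \<xi> g x) (at 0)"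
    using DERIV_mult[OF DERIV_hpoly_line[OF assms(1)] DERIV_hpoly_line[OF assms(2)]] by (simp add: ac_simps)
  then show "ddir \<xi> (\<lambda>x. f x * g x) x = ddir \<xi> f x * g x + f x * ddir \<xi> g x"
    unfolding ddir_def[of _ "\<lambda>x. f x * g x"] by (rule DERIV_imp_deriv)
qed

lemma ddir_inner: "ddir \<xi> (\<lambda>x. \<eta> \<bullet> x) = (\<lambda>x. \<eta> \<bullet> \<xi>)"
proof
  fix x
  have "((\<lambda>t. \<eta> \<bullet> (x + t *\<^sub>R \<xi>)) has_real_derivative \<eta> \<bullet> \<xi>) (at 0)"
    by (auto intro!: derivative_eq_intros simp: inner_add_right)
  then show "ddir \<xi> (\<lambda>x. \<eta> \<bullet> x) x = \<eta> \<bullet> \<xi>"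
    unfolding ddir_def by (rule DERIV_imp_deriv)
qed

lemma hpoly_inner: "hpoly 1 (\<lambda>x. \<eta> \<bullet> x)"
  using hpoly_inner_mult[OF hpoly.const[of 1]] by simp

lemma diffquot_const: "diffquot \<alpha> (\<lambda>x. c) = (\<lambda>x. 0)"
  by (auto simp: diffquot_def ddir_const fun_eq_iff)

lemma diffquot_add:
  assumes "hpoly l f" "hpoly k g"
  shows "diffquot \<alpha> (\<lambda>x. f x + g x) = (\<lambda>x. diffquot \<alpha> f x + diffquot \<alpha> g x)"
  by (auto simp: diffquot_def ddir_add[OF assms] fun_eq_iff add_divide_distrib diff_divide_distrib distrib_left)

text \<open>Insert f(r x) = f x - <\<alpha>,x> Q f x, with Q the quotient and r the reflection, and
  the same for g, into the reflected product; the quadratic term is the defect from the Leibniz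
  rule. On the hyperplane the defect vanishes and Q is a derivation.\<close>

lemma diffquot_mult:
  assumes "hpoly l f" "hpoly k g"
  shows "diffquot \<alpha> (\<lambda>x. f x * g x) x
    = diffquot \<alpha> f x * g x + f x * diffquot \<alpha> g x - (\<alpha> \<bullet> x) * (diffquot \<alpha> f x * diffquot \<alpha> g x)"
  by (auto simp: diffquot_def ddir_mult[OF assms] field_simps add_divide_distrib)

lemma diffquot_refl: 
  assumes "\<alpha> \<noteq> 0"
  shows "diffquot \<alpha> f (refl \<alpha> x) = diffquot \<alpha> f x"
proof -
  have "\<alpha> \<bullet> refl \<alpha> x = - (\<alpha> \<bullet> x)"
    using inner_refl_swap[OF assms, of \<alpha> x] by (simp add: refl_self assms)
  then show ?thesis
    by (auto simp: diffquot_def refl_refl assms refl_fixed field_simps)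
qed

lemma inner_mult_diffquot: "(\<alpha> \<bullet> x) * diffquot \<alpha> f x = f x - f (refl \<alpha> x)"
  by (auto simp: diffquot_def refl_fixed)

text \<open>The quotient of a linear form is the constant 2 <\<alpha>,\<eta>> / <\<alpha>,\<alpha>>,
  and the product rule then gathers the terms it multiplies into f at the reflected point.\<close>

lemma diffquot_inner_mult:
  assumes "hpoly l f" "\<alpha> \<noteq> 0"
  shows "diffquot \<alpha> (\<lambda>x. (\<eta> \<bullet> x) * f x) x
    = (\<eta> \<bullet> x) * diffquot \<alpha> f x + 2 * (\<alpha> \<bullet> \<eta>) / (\<alpha> \<bullet> \<alpha>) * f (refl \<alpha> x)"
proof (cases "\<alpha> \<bullet> x = 0")
  case True
  then show ?thesis
    by (simp add: diffquot_def ddir_mult[OF hpoly_inner assms(1)] ddir_inner refl_fixed inner_commute[of \<eta> \<alpha>])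
      (simp add: algebra_simps add_divide_distrib)
next
  case False
  have "\<eta> \<bullet> refl \<alpha> x = \<eta> \<bullet> x - 2 * (\<alpha> \<bullet> x) * (\<alpha> \<bullet> \<eta>) / (\<alpha> \<bullet> \<alpha>)"
    by (simp add: refl_def inner_diff_right inner_commute[of \<eta> \<alpha>])
  with False assms(2) show ?thesis
    by (simp add: diffquot_def) (simp add: field_simps)
qed

text \<open>Divisibility by the linear form is never shown directly: the rule for a linear factor
  carries the quotient through the induction. The clauses are separate because the truncated degree
  \<open>l - 1\<close> would forget that constants are sent to 0.\<close>

lemma hpoly_diffquot: 
  assumes "\<alpha> \<noteq> 0"
  shows "hpoly l f \<Longrightarrow> (l = 0 \<longrightarrow> diffquot \<alpha> f = (\<lambda>x. 0)) \<and> (l > 0 \<longrightarrow> hpoly (l - 1) (diffquot \<alpha> f))"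
proof (induction rule: hpoly.induct)
  case (mult l f j)
  have e: "diffquot \<alpha> (\<lambda>x. x $ j * f x) = (\<lambda>x. x $ j * diffquot \<alpha> f x + 2 * \<alpha> $ j / (\<alpha> \<bullet> \<alpha>) * f (refl \<alpha> x))"
    using diffquot_inner_mult[OF mult.hyps assms, of "axis j 1"] by (simp add: fun_eq_iff inner_axis inner_axis')
  have "hpoly l (\<lambda>x. x $ j * diffquot \<alpha> f x)"
    using mult.IH hpoly.mult[of "l - 1" "diffquot \<alpha> f" j] by (cases l) (auto intro: hpoly_zero)
  from hpoly.add[OF this hpoly_cmult[OF hpoly_refl[OF mult.hyps]], of "2 * \<alpha> $ j / (\<alpha> \<bullet> \<alpha>)" \<alpha>] show ?case unfolding e by simp
qed (auto simp: diffquot_const diffquot_add intro!: hpoly.add)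

lemma hpoly_ddir: "hpoly l f \<Longrightarrow> (l = 0 \<longrightarrow> ddir \<xi> f = (\<lambda>x. 0)) \<and> (l > 0 \<longrightarrow> hpoly (l - 1) (ddir \<xi> f))"
proof (induction rule: hpoly.induct)
  case (mult l f j)
  have e: "ddir \<xi> (\<lambda>x. x $ j * f x) = (\<lambda>x. \<xi> $ j * f x + x $ j * ddir \<xi> f x)"
    using ddir_mult[OF hpoly_inner mult.hyps, of \<xi> "axis j 1"] ddir_inner[of \<xi> "axis j 1"]
    by (simp add: fun_eq_iff inner_axis inner_axis')
  have "hpoly l (\<lambda>x. x $ j * ddir \<xi> f x)"
    using mult.IH hpoly.mult[of "l - 1" "ddir \<xi> f" j] by (cases l) (auto intro: hpoly_zero)
  then show ?case unfolding e using mult.hyps by (auto intro!: hpoly.add hpoly_cmult hpoly_refl)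
qed (auto simp: ddir_const ddir_add intro!: hpoly.add)

section \<open>Algebra of the Dunkl operators\<close>

locale dunkl_setting =
  fixes R Rp :: "(real^'n) set" and \<kappa> :: "real^'n \<Rightarrow> real"
  assumes root_system: "root_system R"
    and positive_system: "positive_system R Rp"
    and multiplicity: "multiplicity R \<kappa>"
begin

section \<open>Invariance of sums and products over the positive roots\<close>

lemma Rp_subset: "Rp \<subseteq> R"
  using positive_system by (auto simp: positive_system_def)

lemma finite_Rp: "finite Rp"
  using Rp_subset root_system finite_subset by (auto simp: root_system_def)

lemma root_nonzero: "\<alpha> \<in> R \<Longrightarrow> \<alpha> \<noteq> 0"
  using root_system by (auto simp: root_system_def)

lemma Rp_nonzero: "\<alpha> \<in> Rp \<Longrightarrow> \<alpha> \<noteq> 0"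
  using Rp_subset root_nonzero by auto

lemma refl_root: "\<alpha> \<in> R \<Longrightarrow> \<beta> \<in> R \<Longrightarrow> refl \<alpha> \<beta> \<in> R"
  using root_system by (auto simp: root_system_def)

lemma kappa_refl: "\<alpha> \<in> R \<Longrightarrow> \<beta> \<in> R \<Longrightarrow> \<kappa> (refl \<alpha> \<beta>) = \<kappa> \<beta>"
  using multiplicity refl_group.step[OF refl_group.id, of \<alpha> R] by (auto simp: multiplicity_def)

lemma minus_root: "\<alpha> \<in> R \<Longrightarrow> - \<alpha> \<in> R"
  using refl_root[of \<alpha> \<alpha>] by (simp add: refl_self root_nonzero)

lemma kappa_minus: "\<alpha> \<in> R \<Longrightarrow> \<kappa> (- \<alpha>) = \<kappa> \<alpha>"
  using kappa_refl[of \<alpha> \<alpha>] by (simp add: refl_self root_nonzero)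

lemma kappa_nonneg: "\<alpha> \<in> Rp \<Longrightarrow> \<kappa> \<alpha> \<ge> 0"
  using multiplicity Rp_subset by (auto simp: multiplicity_def)

lemma Rp_cases:
  assumes "\<alpha> \<in> R"
  shows "(\<alpha> \<in> Rp) \<noteq> (- \<alpha> \<in> Rp)"
proof -
  obtain v where v: "\<forall>\<alpha>\<in>R. \<alpha> \<bullet> v \<noteq> 0" "Rp = {\<alpha>\<in>R. \<alpha> \<bullet> v > 0}"
    using positive_system by (auto simp: positive_system_def)
  with assms minus_root[OF assms] have "\<alpha> \<bullet> v \<noteq> 0" by auto
  then show ?thesis using v(2) assms minus_root[OF assms] by auto
qed

text \<open>A reflection permutes \<open>R\<close> but not \<open>Rp\<close>. Replacing each image
  by its positive representative gives an involution of \<open>Rp\<close>.\<close>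

definition refl_pos :: "real^'n \<Rightarrow> real^'n \<Rightarrow> real^'n" where
  "refl_pos \<beta> \<alpha> = (if refl \<beta> \<alpha> \<in> Rp then refl \<beta> \<alpha> else - refl \<beta> \<alpha>)"

lemma bij_refl_pos:
  assumes "\<beta> \<in> R"
  shows "bij_betw (refl_pos \<beta>) Rp Rp"
proof (rule bij_betwI[where g = "refl_pos \<beta>"])
  have *: "refl_pos \<beta> \<alpha> \<in> Rp" if "\<alpha> \<in> Rp" for \<alpha>
    using Rp_cases[of "refl \<beta> \<alpha>"] refl_root assms that Rp_subset by (auto simp: refl_pos_def)
  then show "refl_pos \<beta> \<in> Rp \<rightarrow> Rp" "refl_pos \<beta> \<in> Rp \<rightarrow> Rp" by auto
  show "refl_pos \<beta> (refl_pos \<beta> \<alpha>) = \<alpha>" if "\<alpha> \<in> Rp" for \<alpha>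
    using that Rp_cases[of \<alpha>] Rp_subset root_nonzero[OF assms] by (auto simp: refl_pos_def refl_refl refl_minus)
  then show "refl_pos \<beta> (refl_pos \<beta> \<alpha>) = \<alpha>" if "\<alpha> \<in> Rp" for \<alpha> using that .
qed

text \<open>A function that is even in the root does not see the choice of representative, so the
  sum can be reindexed along \<open>refl_pos\<close>.\<close>

lemma sum_Rp_refl:
  fixes F :: "real^'n \<Rightarrow> real"
  assumes "\<beta> \<in> R" "\<And>\<alpha>. \<alpha> \<in> R \<Longrightarrow> F (- \<alpha>) = F \<alpha>"
  shows "(\<Sum>\<alpha>\<in>Rp. F (refl \<beta> \<alpha>)) = (\<Sum>\<alpha>\<in>Rp. F \<alpha>)"
proof -
  have "(\<Sum>\<alpha>\<in>Rp. F (refl \<beta> \<alpha>)) = (\<Sum>\<alpha>\<in>Rp. F (refl_pos \<beta> \<alpha>))"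
    using assms refl_root Rp_subset by (intro sum.cong) (auto simp: refl_pos_def)
  also have "\<dots> = (\<Sum>\<alpha>\<in>Rp. F \<alpha>)" by (rule sum.reindex_bij_betw[OF bij_refl_pos[OF assms(1)]])
  finally show ?thesis .
qed

lemma prod_Rp_refl:
  fixes F :: "real^'n \<Rightarrow> real"
  assumes "\<beta> \<in> R" "\<And>\<alpha>. \<alpha> \<in> R \<Longrightarrow> F (- \<alpha>) = F \<alpha>"
  shows "(\<Prod>\<alpha>\<in>Rp. F (refl \<beta> \<alpha>)) = (\<Prod>\<alpha>\<in>Rp. F \<alpha>)"
proof -
  have "(\<Prod>\<alpha>\<in>Rp. F (refl \<beta> \<alpha>)) = (\<Prod>\<alpha>\<in>Rp. F (refl_pos \<beta> \<alpha>))"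
    using assms refl_root Rp_subset by (intro prod.cong) (auto simp: refl_pos_def)
  also have "\<dots> = (\<Prod>\<alpha>\<in>Rp. F \<alpha>)" by (rule prod.reindex_bij_betw[OF bij_refl_pos[OF assms(1)]])
  finally show ?thesis .
qed

section \<open>Dunkl operators on homogeneous polynomials\<close>

abbreviation \<D> where "\<D> \<equiv> dunkl Rp \<kappa>"
abbreviation Lap where "Lap \<equiv> dunkl_laplacian Rp \<kappa>"

text \<open>The commutator of \<open>D\<^sub>\<xi>\<close> with multiplication by \<open>\<langle>\<eta>,x\<rangle>\<close>.\<close>

definition comm_coord :: "real^'n \<Rightarrow> real^'n \<Rightarrow> (real^'n \<Rightarrow> real) \<Rightarrow> real^'n \<Rightarrow> real" where
  "comm_coord \<xi> \<eta> f x = (\<xi> \<bullet> \<eta>) * f x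
     + (\<Sum>\<alpha>\<in>Rp. \<kappa> \<alpha> * (\<alpha> \<bullet> \<xi>) * (2 * (\<alpha> \<bullet> \<eta>) / (\<alpha> \<bullet> \<alpha>)) * f (refl \<alpha> x))"

lemma dunkl_diffquot: "\<D> \<xi> f x = ddir \<xi> f x + (\<Sum>\<alpha>\<in>Rp. \<kappa> \<alpha> * (\<alpha> \<bullet> \<xi>) * diffquot \<alpha> f x)"
  by (simp add: dunkl_def diffquot_def)

lemma dunkl_const: "\<D> \<xi> (\<lambda>x. c) = (\<lambda>x. 0)"
  by (simp add: fun_eq_iff dunkl_diffquot ddir_const diffquot_const)

lemma dunkl_add:
  assumes "hpoly l f" "hpoly k g"
  shows "\<D> \<xi> (\<lambda>x. f x + g x) = (\<lambda>x. \<D> \<xi> f x + \<D> \<xi> g x)"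
  by (simp add: fun_eq_iff dunkl_diffquot ddir_add[OF assms] diffquot_add[OF assms] distrib_left sum.distrib)

lemma dunkl_inner_mult:
  assumes "hpoly l f"
  shows "\<D> \<xi> (\<lambda>x. (\<eta> \<bullet> x) * f x) = (\<lambda>x. (\<eta> \<bullet> x) * \<D> \<xi> f x + comm_coord \<xi> \<eta> f x)"
proof
  fix x
  have "(\<Sum>\<alpha>\<in>Rp. \<kappa> \<alpha> * (\<alpha> \<bullet> \<xi>) * diffquot \<alpha> (\<lambda>x. (\<eta> \<bullet> x) * f x) x)
    = (\<Sum>\<alpha>\<in>Rp. (\<eta> \<bullet> x) * (\<kappa> \<alpha> * (\<alpha> \<bullet> \<xi>) * diffquot \<alpha> f x) 
        + \<kappa> \<alpha> * (\<alpha> \<bullet> \<xi>) * (2 * (\<alpha> \<bullet> \<eta>) / (\<alpha> \<bullet> \<alpha>)) * f (refl \<alpha> x))"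
    by (intro sum.cong refl, subst diffquot_inner_mult[OF assms Rp_nonzero]) (simp_all add: algebra_simps)
  then show "\<D> \<xi> (\<lambda>x. (\<eta> \<bullet> x) * f x) x = (\<eta> \<bullet> x) * \<D> \<xi> f x + comm_coord \<xi> \<eta> f x"
    by (simp add: dunkl_diffquot comm_coord_def ddir_mult[OF hpoly_inner assms] ddir_inner
        sum.distrib sum_distrib_left distrib_left inner_commute[of \<eta> \<xi>])
qed

lemma dunkl_coord_mult:
  assumes "hpoly l f"
  shows "\<D> \<xi> (\<lambda>x. x $ j * f x) = (\<lambda>x. x $ j * \<D> \<xi> f x + comm_coord \<xi> (axis j 1) f x)"
  using dunkl_inner_mult[OF assms, of \<xi> "axis j 1"] by (simp add: inner_axis')

lemma hpoly_comm_coord: "hpoly l f \<Longrightarrow> hpoly l (comm_coord \<xi> \<eta> f)"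
  unfolding comm_coord_def[abs_def] by (intro hpoly.add hpoly_sum hpoly_cmult hpoly_refl)

lemma hpoly_dunkl: "hpoly (Suc l) f \<Longrightarrow> hpoly l (\<D> \<xi> f)"
  unfolding dunkl_diffquot[abs_def]
  using hpoly_ddir[of "Suc l" f \<xi>] hpoly_diffquot[OF Rp_nonzero, of _ "Suc l" f]
  by (intro hpoly.add hpoly_sum hpoly_cmult) auto

lemma dunkl_hpoly_0: "hpoly 0 f \<Longrightarrow> \<D> \<xi> f = (\<lambda>x. 0)"
  by (erule hpoly_0E) (simp add: dunkl_const)

lemma hpoly_dunkl_any: "hpoly l f \<Longrightarrow> hpoly (l - 1) (\<D> \<xi> f)"
  by (cases l) (auto simp: dunkl_hpoly_0 hpoly_zero hpoly_dunkl)

lemma hpoly_mult_dunkl: "hpoly l f \<Longrightarrow> hpoly l (\<lambda>x. x $ j * \<D> \<xi> f x)"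
  using hpoly.mult[OF hpoly_dunkl] by (cases l) (auto simp: dunkl_hpoly_0 hpoly_zero)

lemma dunkl_cmult: "hpoly l f \<Longrightarrow> \<D> \<xi> (\<lambda>x. c * f x) = (\<lambda>x. c * \<D> \<xi> f x)"
proof (induction rule: hpoly.induct)
  case (mult l f j)
  have "\<D> \<xi> (\<lambda>x. x $ j * (c * f x)) = (\<lambda>x. c * (x $ j * \<D> \<xi> f x + comm_coord \<xi> (axis j 1) f x))"
    unfolding dunkl_coord_mult[OF hpoly_cmult[OF mult.hyps]] mult.IH
    by (simp add: comm_coord_def sum_distrib_left algebra_simps fun_eq_iff)
  then show ?case unfolding dunkl_coord_mult[OF mult.hyps] by (simp add: mult.left_commute)
next
  case (add l f g)
  then show ?case by (simp add: distrib_left dunkl_add[OF hpoly_cmult hpoly_cmult] dunkl_add)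
qed (simp add: dunkl_const)

lemma dunkl_sum:
  assumes "\<And>i. i \<in> A \<Longrightarrow> hpoly l (f i)"
  shows "\<D> \<xi> (\<lambda>x. \<Sum>i\<in>A. f i x) = (\<lambda>x. \<Sum>i\<in>A. \<D> \<xi> (f i) x)"
  using assms
proof (induction A rule: infinite_finite_induct)
  case (insert i A)
  then have "hpoly l (f i)" "hpoly l (\<lambda>x. \<Sum>i\<in>A. f i x)" by (auto intro: hpoly_sum)
  from dunkl_add[OF this] insert show ?case by simp
qed (auto simp: dunkl_const)

lemma dunkl_diff:
  assumes "hpoly l f" "hpoly k g"
  shows "\<D> \<xi> (\<lambda>x. f x - g x) = (\<lambda>x. \<D> \<xi> f x - \<D> \<xi> g x)"
  using dunkl_add[OF assms(1) hpoly_cmult[OF assms(2), of "-1"]] dunkl_cmult[OF assms(2), of _ "-1"]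
  by simp

text \<open>Linearity in the direction cannot be read off from \<open>deriv\<close> along a line. It
  passes through the induction because \<open>comm_coord\<close> is linear in its first
  argument.\<close>

lemma dunkl_linear_direction:
  assumes "hpoly l f"
  shows "\<D> (\<xi> + c *\<^sub>R \<eta>) f x = \<D> \<xi> f x + c * \<D> \<eta> f x"
  using assms
proof (induction arbitrary: x rule: hpoly.induct)
  case (mult l f j)
  show ?case
    unfolding dunkl_coord_mult[OF mult.hyps] mult.IH
    by (simp add: comm_coord_def inner_add_left inner_add_right sum.distrib algebra_simps sum_distrib_left
       add_divide_distrib)
qed (auto simp: dunkl_const dunkl_add algebra_simps)

lemma dunkl_sum_direction:
  assumes "hpoly l f"
  shows "(\<Sum>i\<in>UNIV. \<xi> $ i * \<D> (axis i 1) f x) = \<D> \<xi> f x"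
proof -
  have *: "\<D> (\<Sum>i\<in>A. \<xi> $ i *\<^sub>R axis i 1) f x = (\<Sum>i\<in>A. \<xi> $ i * \<D> (axis i 1) f x)" if "finite A" for A
    using that
  proof induction
    case empty
    \<comment> \<open>The instance reads D_0 f = D_0 f + D_0 f, which forces D_0 f = 0.\<close>
    show ?case using dunkl_linear_direction[OF assms, of 0 1 0] by simp
  next
    case (insert i A)
    then show ?case
      using dunkl_linear_direction[OF assms, of "\<Sum>i\<in>A. \<xi> $ i *\<^sub>R axis i 1" "\<xi> $ i" "axis i 1"]
      by (simp add: add.commute)
  qed
  have "(\<Sum>i\<in>UNIV. \<xi> $ i *\<^sub>R axis i 1) = \<xi>"
    using basis_expansion[of \<xi>] by (simp add: scalar_mult_eq_scaleR)
  with *[of UNIV] show ?thesis by simp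
qed

lemma comm_coord_refl:
  assumes "\<beta> \<in> R"
  shows "comm_coord (refl \<beta> \<xi>) (refl \<beta> \<eta>) (\<lambda>x. f (refl \<beta> x)) x = comm_coord \<xi> \<eta> f (refl \<beta> x)"
proof -
  note b = root_nonzero[OF assms]
  define F where "F \<alpha> = \<kappa> \<alpha> * (\<alpha> \<bullet> refl \<beta> \<xi>) * (2 * (\<alpha> \<bullet> refl \<beta> \<eta>) / (\<alpha> \<bullet> \<alpha>)) * f (refl \<beta> (refl \<alpha> x))" for \<alpha>
  have "(\<Sum>\<alpha>\<in>Rp. F \<alpha>) = (\<Sum>\<alpha>\<in>Rp. F (refl \<beta> \<alpha>))"
    by (rule sum_Rp_refl[OF assms, symmetric]) (auto simp: F_def kappa_minus refl_minus)
  also have "\<dots> = (\<Sum>\<alpha>\<in>Rp. \<kappa> \<alpha> * (\<alpha> \<bullet> \<xi>) * (2 * (\<alpha> \<bullet> \<eta>) / (\<alpha> \<bullet> \<alpha>)) * f (refl \<alpha> (refl \<beta> x)))"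
    using Rp_subset assms by (intro sum.cong refl) (auto simp: F_def kappa_refl inner_refl b refl_conj)
  finally show ?thesis by (simp add: comm_coord_def F_def inner_refl b)
qed

text \<open>Reflecting turns a coordinate into the linear form given by
  \<open>refl \<beta> (axis j 1)\<close>; this is why the commutator is studied for arbitrary linear
  forms and not only for coordinates.\<close>

lemma dunkl_refl:
  assumes "\<beta> \<in> R"
  shows "hpoly l f \<Longrightarrow> \<D> (refl \<beta> \<xi>) (\<lambda>x. f (refl \<beta> x)) x = \<D> \<xi> f (refl \<beta> x)"
proof (induction arbitrary: x rule: hpoly.induct)
  case (mult l f j)
  have *: "refl \<beta> x $ j = refl \<beta> (axis j 1) \<bullet> x" for x
    using inner_refl_swap[OF root_nonzero[OF assms], of "axis j 1" x] by (simp add: inner_axis')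
  show ?case
    unfolding * dunkl_inner_mult[OF hpoly_refl[OF mult.hyps]] dunkl_coord_mult[OF mult.hyps]
    by (simp add: mult.IH comm_coord_refl[OF assms] *)
qed (auto simp: dunkl_const dunkl_add[OF hpoly_refl hpoly_refl] dunkl_add)

text \<open>Equivariance in the direction \<open>refl \<alpha> \<xi>\<close>, with that direction
  expanded by linearity.\<close>

lemma dunkl_of_refl:
  assumes "\<alpha> \<in> R" "hpoly l f"
  shows "\<D> \<xi> (\<lambda>x. f (refl \<alpha> x)) x = \<D> \<xi> f (refl \<alpha> x) - 2 * (\<alpha> \<bullet> \<xi>) / (\<alpha> \<bullet> \<alpha>) * \<D> \<alpha> f (refl \<alpha> x)"
  using dunkl_refl[OF assms, of "refl \<alpha> \<xi>" x] refl_refl[OF root_nonzero[OF assms(1)], of \<xi>]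
    dunkl_linear_direction[OF assms(2), of \<xi> "- (2 * (\<alpha> \<bullet> \<xi>) / (\<alpha> \<bullet> \<alpha>))" \<alpha> "refl \<alpha> x"]
  by (simp add: refl_def[of \<alpha> \<xi>])

lemma dunkl_comm_coord:
  assumes "hpoly l f"
  shows "\<D> \<xi> (comm_coord \<eta> \<zeta> f) x = (\<eta> \<bullet> \<zeta>) * \<D> \<xi> f x
    + (\<Sum>\<alpha>\<in>Rp. \<kappa> \<alpha> * (\<alpha> \<bullet> \<eta>) * (2 * (\<alpha> \<bullet> \<zeta>) / (\<alpha> \<bullet> \<alpha>)) * \<D> \<xi> (\<lambda>x. f (refl \<alpha> x)) x)"
  unfolding comm_coord_def[abs_def]
  by (subst dunkl_add[of l _ l] dunkl_cmult[of l] dunkl_sum[of _ l]; 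
      (intro hpoly_sum hpoly_cmult hpoly_refl assms)?)+ simp

text \<open>The commutator \<open>[D\<^sub>\<xi>, D\<^sub>\<eta>]\<close> commutes with every coordinate and kills constants.\<close>

lemma dunkl_commute: "hpoly l f \<Longrightarrow> \<D> \<xi> (\<D> \<eta> f) = \<D> \<eta> (\<D> \<xi> f)"
proof (induction rule: hpoly.induct)
  case (mult l f j)
  \<comment> \<open>Apart from its first summand the right-hand side is symmetric in \<xi> and
    \<eta>; the first summand is left to the induction hypothesis.\<close>
  have *: "\<D> \<xi> (\<D> \<eta> (\<lambda>x. x $ j * f x)) x = x $ j * \<D> \<xi> (\<D> \<eta> f) x
    + (\<xi> $ j * \<D> \<eta> f x + \<eta> $ j * \<D> \<xi> f x)
    + (\<Sum>\<alpha>\<in>Rp. \<kappa> \<alpha> * (2 * \<alpha> $ j / (\<alpha> \<bullet> \<alpha>)) * ((\<alpha> \<bullet> \<xi>) * \<D> \<eta> f (refl \<alpha> x) + (\<alpha> \<bullet> \<eta>) * \<D> \<xi> f (refl \<alpha> x)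
      - (\<alpha> \<bullet> \<xi>) * (\<alpha> \<bullet> \<eta>) * 2 / (\<alpha> \<bullet> \<alpha>) * \<D> \<alpha> f (refl \<alpha> x)))" for \<xi> \<eta> x
  proof -
    have "\<D> \<xi> (\<D> \<eta> (\<lambda>x. x $ j * f x)) x = \<D> \<xi> (\<lambda>x. x $ j * \<D> \<eta> f x) x + \<D> \<xi> (comm_coord \<eta> (axis j 1) f) x"
      unfolding dunkl_coord_mult[OF mult.hyps] 
      by (subst dunkl_add[OF hpoly_mult_dunkl[OF mult.hyps] hpoly_comm_coord[OF mult.hyps]]) simp
    also have "\<D> \<xi> (\<lambda>x. x $ j * \<D> \<eta> f x) x = x $ j * \<D> \<xi> (\<D> \<eta> f) x + comm_coord \<xi> (axis j 1) (\<D> \<eta> f) x"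
      by (subst dunkl_coord_mult[OF hpoly_dunkl_any[OF mult.hyps]]) simp
    also have "\<D> \<xi> (comm_coord \<eta> (axis j 1) f) x = (\<eta> \<bullet> axis j 1) * \<D> \<xi> f x
      + (\<Sum>\<alpha>\<in>Rp. \<kappa> \<alpha> * (\<alpha> \<bullet> \<eta>) * (2 * (\<alpha> \<bullet> axis j 1) / (\<alpha> \<bullet> \<alpha>)) * 
           (\<D> \<xi> f (refl \<alpha> x) - 2 * (\<alpha> \<bullet> \<xi>) / (\<alpha> \<bullet> \<alpha>) * \<D> \<alpha> f (refl \<alpha> x)))"
      unfolding dunkl_comm_coord[OF mult.hyps] using Rp_subset
      by (intro arg_cong2[where f = "(+)"] sum.cong refl) (simp add: dunkl_of_refl[OF _ mult.hyps] subset_iff)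
    finally have "\<D> \<xi> (\<D> \<eta> (\<lambda>x. x $ j * f x)) x = x $ j * \<D> \<xi> (\<D> \<eta> f) x
      + (\<xi> $ j * \<D> \<eta> f x + \<eta> $ j * \<D> \<xi> f x)
      + ((\<Sum>\<alpha>\<in>Rp. \<kappa> \<alpha> * (\<alpha> \<bullet> \<xi>) * (2 * \<alpha> $ j / (\<alpha> \<bullet> \<alpha>)) * \<D> \<eta> f (refl \<alpha> x))
      + (\<Sum>\<alpha>\<in>Rp. \<kappa> \<alpha> * (\<alpha> \<bullet> \<eta>) * (2 * \<alpha> $ j / (\<alpha> \<bullet> \<alpha>)) * 
           (\<D> \<xi> f (refl \<alpha> x) - 2 * (\<alpha> \<bullet> \<xi>) / (\<alpha> \<bullet> \<alpha>) * \<D> \<alpha> f (refl \<alpha> x))))"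
      by (simp add: comm_coord_def inner_axis)
    then show ?thesis
      unfolding sum.distrib[symmetric] by (simp add: algebra_simps diff_divide_distrib add_divide_distrib)
  qed
  show ?case
    unfolding fun_eq_iff * by (simp add: mult.IH algebra_simps)
qed (auto simp: dunkl_const dunkl_add[OF hpoly_dunkl_any hpoly_dunkl_any] dunkl_add)

section \<open>The Dunkl Laplacian\<close>

lemma laplacian_eq: "Lap f = (\<lambda>x. \<Sum>j\<in>UNIV. \<D> (axis j 1) (\<D> (axis j 1) f) x)"
  by (simp add: dunkl_laplacian_def[abs_def] dunkl_j_def)

lemma hpoly_laplacian: "hpoly l f \<Longrightarrow> hpoly (l - 2) (Lap f)"
  unfolding laplacian_eq using hpoly_dunkl_any[OF hpoly_dunkl_any] by (intro hpoly_sum) (simp add: numeral_2_eq_2)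

lemma laplacian_add:
  assumes "hpoly l f" "hpoly k g"
  shows "Lap (\<lambda>x. f x + g x) = (\<lambda>x. Lap f x + Lap g x)"
  unfolding laplacian_eq
  by (simp add: dunkl_add[OF assms] dunkl_add[OF hpoly_dunkl_any[OF assms(1)] hpoly_dunkl_any[OF assms(2)]] sum.distrib)

lemma laplacian_cmult:
  assumes "hpoly l f"
  shows "Lap (\<lambda>x. c * f x) = (\<lambda>x. c * Lap f x)"
  unfolding laplacian_eq
  by (simp add: dunkl_cmult[OF assms] dunkl_cmult[OF hpoly_dunkl_any[OF assms]] sum_distrib_left)

lemma laplacian_const: "Lap (\<lambda>x. c) = (\<lambda>x. 0)"
  by (simp add: laplacian_eq dunkl_const)

lemma laplacian_dunkl_commute:
  assumes "hpoly l f"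
  shows "Lap (\<D> \<xi> f) = \<D> \<xi> (Lap f)"
  unfolding laplacian_eq
  by (subst dunkl_sum[OF hpoly_dunkl_any[OF hpoly_dunkl_any[OF assms]]])
    (simp add: dunkl_commute[OF assms, of _ \<xi>] dunkl_commute[OF hpoly_dunkl_any[OF assms], of _ \<xi>])

text \<open>Summed over the basis, the two commutators produce the same reflection sum with opposite
  signs, because D_\<alpha> applied to the reflected f is minus D_\<alpha> f at the reflected point.
  Only the two copies of D_j remain.\<close>

lemma laplacian_coord_mult:
  assumes "hpoly l f"
  shows "Lap (\<lambda>x. x $ j * f x) = (\<lambda>x. x $ j * Lap f x + 2 * \<D> (axis j 1) f x)"
proof
  fix x
  let ?e = "\<lambda>i. axis i 1 :: real^'n"
  have 1: "\<D> (?e i) (\<D> (?e i) (\<lambda>x. x $ j * f x)) x = x $ j * \<D> (?e i) (\<D> (?e i) f) x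
     + (comm_coord (?e i) (?e j) (\<D> (?e i) f) x + \<D> (?e i) (comm_coord (?e i) (?e j) f) x)" for i
    unfolding dunkl_coord_mult[OF assms]
    by (subst dunkl_add[OF hpoly_mult_dunkl[OF assms] hpoly_comm_coord[OF assms]])
      (simp add: dunkl_coord_mult[OF hpoly_dunkl_any[OF assms]])
  have d: "?e i $ j = ?e j $ i" for i by (simp add: axis_def)
  have "(\<Sum>i\<in>UNIV. comm_coord (?e i) (?e j) (\<D> (?e i) f) x)
    = \<D> (?e j) f x + (\<Sum>\<alpha>\<in>Rp. \<kappa> \<alpha> * (2 * (\<alpha> \<bullet> ?e j) / (\<alpha> \<bullet> \<alpha>)) * (\<Sum>i\<in>UNIV. \<alpha> $ i * \<D> (?e i) f (refl \<alpha> x)))"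
    unfolding comm_coord_def sum.distrib dunkl_sum_direction[OF assms, of "?e j" x, symmetric]
    by (subst sum.swap) (simp add: d inner_axis sum_distrib_left ac_simps)
  then have 2: "(\<Sum>i\<in>UNIV. comm_coord (?e i) (?e j) (\<D> (?e i) f) x)
    = \<D> (?e j) f x + (\<Sum>\<alpha>\<in>Rp. \<kappa> \<alpha> * (2 * (\<alpha> \<bullet> ?e j) / (\<alpha> \<bullet> \<alpha>)) * \<D> \<alpha> f (refl \<alpha> x))"
    by (simp only: dunkl_sum_direction[OF assms])
  have "(\<Sum>i\<in>UNIV. \<D> (?e i) (comm_coord (?e i) (?e j) f) x)
    = \<D> (?e j) f x + (\<Sum>\<alpha>\<in>Rp. \<kappa> \<alpha> * (2 * (\<alpha> \<bullet> ?e j) / (\<alpha> \<bullet> \<alpha>)) * (\<Sum>i\<in>UNIV. \<alpha> $ i * \<D> (?e i) (\<lambda>x. f (refl \<alpha> x)) x))"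
    unfolding dunkl_comm_coord[OF assms] sum.distrib dunkl_sum_direction[OF assms, of "?e j" x, symmetric]
    by (subst sum.swap) (simp add: d inner_axis sum_distrib_left ac_simps)
  also have "\<dots> = \<D> (?e j) f x + (\<Sum>\<alpha>\<in>Rp. \<kappa> \<alpha> * (2 * (\<alpha> \<bullet> ?e j) / (\<alpha> \<bullet> \<alpha>)) * \<D> \<alpha> (\<lambda>x. f (refl \<alpha> x)) x)"
    by (simp only: dunkl_sum_direction[OF hpoly_refl[OF assms]])
  also have "\<dots> = \<D> (?e j) f x - (\<Sum>\<alpha>\<in>Rp. \<kappa> \<alpha> * (2 * (\<alpha> \<bullet> ?e j) / (\<alpha> \<bullet> \<alpha>)) * \<D> \<alpha> f (refl \<alpha> x))"
  proof -
    have "\<D> \<alpha> (\<lambda>x. f (refl \<alpha> x)) x = - \<D> \<alpha> f (refl \<alpha> x)" if "\<alpha> \<in> Rp" for \<alpha>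
      using dunkl_of_refl[OF _ assms, of \<alpha> \<alpha> x] that Rp_subset Rp_nonzero[OF that] by auto
    then show ?thesis by (simp add: sum_negf)
  qed
  finally show "Lap (\<lambda>x. x $ j * f x) x = x $ j * Lap f x + 2 * \<D> (axis j 1) f x"
    using 2 by (simp add: laplacian_eq 1 sum.distrib sum_distrib_left)
qed

end

section \<open>Lebesgue measure and the surface measure\<close>

lemma nn_integral_lborel_translation:
  fixes g :: "'a::euclidean_space \<Rightarrow> ennreal"
  assumes [measurable]: "g \<in> borel_measurable borel"
  shows "(\<integral>\<^sup>+x. g (c + x) \<partial>lborel) = (\<integral>\<^sup>+x. g x \<partial>lborel)"
proof -
  have "(\<integral>\<^sup>+x. g x \<partial>lborel) = (\<integral>\<^sup>+x. g x \<partial>distr lborel borel ((+) c))"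
    by (simp add: lborel_distr_plus)
  then show ?thesis by (simp add: nn_integral_distr)
qed

text \<open>Convolving with the indicator of the unit ball, which \<open>f\<close> preserves, compares the image measure
  with Lebesgue measure.\<close>

lemma distr_lborel_orthogonal:
  fixes f :: "'a::euclidean_space \<Rightarrow> 'a"
  assumes "orthogonal_transformation f"
  shows "distr lborel borel f = lborel"
proof (rule measure_eqI)
  have lin: "linear f" and inj: "inj f" and bij: "bij f"
    using assms orthogonal_transformation_linear orthogonal_transformation_inj orthogonal_transformation_bij by auto
  have [measurable]: "f \<in> borel_measurable borel"
    using lin linear_continuous_on linear_conv_bounded_linear borel_measurable_continuous_onI by blast
  define g where "g = inv f"
  have fg: "f (g y) = y" for y using bij by (simp add: g_def bij_is_surj surj_f_inv_f)
  fix A assume "A \<in> sets (distr lborel borel f)"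
  then have [measurable]: "A \<in> sets borel" by simp
  let ?B = "ball 0 1 :: 'a set"
  have [measurable]: "?B \<in> sets borel" by simp
  have B: "emeasure lborel ?B \<noteq> 0" "emeasure lborel ?B \<noteq> \<infinity>"
    using content_ball_pos[of 1 "0::'a"] emeasure_lborel_ball_finite[of "0::'a" 1]
    by (auto simp: measure_def)
  have "emeasure (distr lborel borel f) A = (\<integral>\<^sup>+x. indicator A (f x) \<partial>lborel)"
    by (simp add: nn_integral_distr flip: nn_integral_indicator)
  then have "emeasure lborel ?B * emeasure (distr lborel borel f) A
      = (\<integral>\<^sup>+y. indicator ?B y * (\<integral>\<^sup>+x. indicator A (f x) \<partial>lborel) \<partial>lborel)"
    by (subst nn_integral_multc) auto
  also have "\<dots> = (\<integral>\<^sup>+y. indicator ?B y * (\<integral>\<^sup>+x. indicator A (y + f x) \<partial>lborel) \<partial>lborel)"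
  proof (rule nn_integral_cong)
    fix y
    \<comment> \<open>Translating x by \<open>g y\<close>, the preimage of y, translates
      \<open>f x\<close> by y.\<close>
    show "indicator ?B y * (\<integral>\<^sup>+x. indicator A (f x) \<partial>lborel)
      = indicator ?B y * (\<integral>\<^sup>+x. indicator A (y + f x) \<partial>lborel)"
      using nn_integral_lborel_translation[of "\<lambda>x. indicator A (f x)" "g y"] by (simp add: linear_add[OF lin] fg)
  qed
  also have "\<dots> = (\<integral>\<^sup>+y. (\<integral>\<^sup>+x. indicator ?B y * indicator A (y + f x) \<partial>lborel) \<partial>lborel)"
    by (simp add: nn_integral_cmult)
  also have "\<dots> = (\<integral>\<^sup>+x. (\<integral>\<^sup>+y. indicator ?B y * indicator A (y + f x) \<partial>lborel) \<partial>lborel)"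
    by (rule lborel_pair.Fubini') measurable
  also have "\<dots> = (\<integral>\<^sup>+x. (\<integral>\<^sup>+y. indicator ?B (y - f x) * indicator A y \<partial>lborel) \<partial>lborel)"
  proof (rule nn_integral_cong)
    fix x
    show "(\<integral>\<^sup>+y. indicator ?B y * indicator A (y + f x) \<partial>lborel) = (\<integral>\<^sup>+y. indicator ?B (y - f x) * indicator A y \<partial>lborel)"
      using nn_integral_lborel_translation[of "\<lambda>y. indicator ?B (y - f x) * indicator A y" "f x"] by (simp add: add.commute)
  qed
  also have "\<dots> = (\<integral>\<^sup>+y. (\<integral>\<^sup>+x. indicator ?B (y - f x) * indicator A y \<partial>lborel) \<partial>lborel)"
    by (rule lborel_pair.Fubini') measurable
  also have "\<dots> = (\<integral>\<^sup>+y. emeasure lborel ?B * indicator A y \<partial>lborel)"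
  proof (rule nn_integral_cong)
    fix y
    have "indicator ?B (y - f x) = (indicator ?B (- g y + x) :: ennreal)" for x
    proof -
      have "y - f x = f (g y - x)" by (simp add: linear_diff[OF lin] fg)
      then have "norm (y - f x) = norm (- g y + x)"
        using orthogonal_transformation_norm[OF assms, of "g y - x"] by (simp add: norm_minus_commute)
      then show ?thesis by (simp add: indicator_def)
    qed
    then have "(\<integral>\<^sup>+x. indicator ?B (y - f x) \<partial>lborel) = (\<integral>\<^sup>+x. indicator ?B x \<partial>lborel)"
      using nn_integral_lborel_translation[of "indicator ?B" "- g y"] by simp
    then show "(\<integral>\<^sup>+x. indicator ?B (y - f x) * indicator A y \<partial>lborel) = emeasure lborel ?B * indicator A y"
      by (simp add: nn_integral_multc)
  qed
  also have "\<dots> = emeasure lborel ?B * emeasure lborel A" by (simp add: nn_integral_cmult)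
  finally show "emeasure (distr lborel borel f) A = emeasure lborel A"
    using B by (simp add: ennreal_mult_cancel_left)
qed simp

lemma lborel_integral_orthogonal:
  fixes f :: "'a::euclidean_space \<Rightarrow> 'a" and g :: "'a \<Rightarrow> real"
  assumes "orthogonal_transformation f" and [measurable]: "g \<in> borel_measurable borel"
  shows "(\<integral>x. g (f x) \<partial>lborel) = (\<integral>x. g x \<partial>lborel)"
proof -
  have [measurable]: "f \<in> borel_measurable borel"
    using orthogonal_transformation_linear[OF assms(1)] linear_continuous_on linear_conv_bounded_linear borel_measurable_continuous_onI by blast
  have "(\<integral>x. g x \<partial>lborel) = (\<integral>x. g x \<partial>distr lborel borel f)"
    by (simp add: distr_lborel_orthogonal[OF assms(1)])
  then show ?thesis by (simp add: integral_distr)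
qed

lemma lborel_integral_translation:
  fixes g :: "'a::euclidean_space \<Rightarrow> real"
  assumes [measurable]: "g \<in> borel_measurable borel"
  shows "(\<integral>x. g (x + c) \<partial>lborel) = (\<integral>x. g x \<partial>lborel)"
proof -
  have "(\<integral>x. g x \<partial>lborel) = (\<integral>x. g x \<partial>distr lborel borel ((+) c))"
    by (simp add: lborel_distr_plus)
  then show ?thesis by (simp add: integral_distr add.commute)
qed

lemma lborel_integral_scaleR:
  fixes g :: "'a::euclidean_space \<Rightarrow> real"
  assumes "c \<noteq> 0" and [measurable]: "g \<in> borel_measurable borel"
  shows "(\<integral>x. g x \<partial>lborel) = \<bar>c\<bar> ^ DIM('a) * (\<integral>x. g (c *\<^sub>R x) \<partial>lborel)"
  by (subst lborel_affine[OF assms(1), of 0]) (simp add: integral_density integral_distr)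

text \<open>The cone over \<open>A\<close> is its preimage under radial projection, so the surface
  measure is a push-forward. This also supplies the countable additivity without which
  \<open>measure_of\<close> would return the zero measure.\<close>

lemma sphere_measure_eq_distr:
  "(sphere_measure :: (real^'n) measure) = distr
     (density (restrict_space lborel (cball 0 1 - {0})) (\<lambda>_. ennreal (real CARD('n))))
     (restrict_space borel (sphere 0 1)) sgn" (is "_ = ?N")
proof -
  let ?S = "restrict_space borel (sphere 0 1) :: (real^'n) measure"
  \<comment> \<open>The origin is removed because \<open>sgn 0 = 0\<close> does not lie on the
    sphere.\<close>
  let ?D = "restrict_space lborel (cball 0 1 - {0}) :: (real^'n) measure"
  have sgn[measurable]: "sgn \<in> ?D \<rightarrow>\<^sub>M ?S"
    by (rule measurable_restrict_space2) (auto simp: space_restrict_space norm_sgn intro!: measurable_restrict_space1)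
  have "ennreal (real CARD('n)) * emeasure lborel {t *\<^sub>R x | t x. x \<in> A \<and> 0 < t \<and> t \<le> 1} = emeasure ?N A"
    if A: "A \<in> sets ?S" for A
  proof -
    have sub: "A \<subseteq> sphere 0 1" using sets.sets_into_space[OF A] by (simp add: space_restrict_space)
    have eq: "{t *\<^sub>R x | t x. x \<in> A \<and> 0 < t \<and> t \<le> 1} = sgn -` A \<inter> space ?D"
    proof (intro equalityI subsetI)
      fix y assume "y \<in> {t *\<^sub>R x | t x. x \<in> A \<and> 0 < t \<and> t \<le> 1}"
      then obtain t x where tx: "y = t *\<^sub>R x" "x \<in> A" "0 < t" "t \<le> 1" by auto
      then have "norm x = 1" using sub by auto
      with tx show "y \<in> sgn -` A \<inter> space ?D"
        by (auto simp: space_restrict_space sgn_scaleR) (auto simp: sgn_div_norm)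
    next
      fix y assume "y \<in> sgn -` A \<inter> space ?D"
      then have "y = norm y *\<^sub>R sgn y" "sgn y \<in> A" "0 < norm y" "norm y \<le> 1"
        by (auto simp: space_restrict_space sgn_div_norm)
      then show "y \<in> {t *\<^sub>R x | t x. x \<in> A \<and> 0 < t \<and> t \<le> 1}" by blast
    qed
    have m: "sgn -` A \<inter> space ?D \<in> sets ?D" using measurable_sets[OF sgn A] .
    have "emeasure ?N A = emeasure (density ?D (\<lambda>_. ennreal (real CARD('n)))) (sgn -` A \<inter> space ?D)"
      using A by (subst emeasure_distr) auto
    also have "\<dots> = ennreal (real CARD('n)) * emeasure ?D (sgn -` A \<inter> space ?D)"
      using m by (simp add: emeasure_density nn_integral_cmult)
    also have "emeasure ?D (sgn -` A \<inter> space ?D) = emeasure lborel (sgn -` A \<inter> space ?D)"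
      by (rule emeasure_restrict_space) (auto simp: space_restrict_space)
    finally show ?thesis by (simp add: eq)
  qed
  moreover have "sigma_sets (sphere 0 1) (sets ?S) = sets ?S" "sets ?S \<subseteq> Pow (sphere 0 1)"
    using sets.sigma_sets_eq[of ?S] sets.space_closed[of ?S] by (simp_all add: space_restrict_space)
  ultimately have "sphere_measure = measure_of (sphere 0 1) (sets ?S) (emeasure ?N)"
    unfolding sphere_measure_def by (intro measure_of_eq) simp_all
  then have "sphere_measure = measure_of (space ?N) (sets ?N) (emeasure ?N)"
    by (simp add: space_restrict_space)
  then show ?thesis by (simp only: measure_of_of_measure)
qed

lemma integral_sphere_measure:
  fixes g :: "real^'n \<Rightarrow> real"
  assumes [measurable]: "g \<in> borel_measurable borel"
  shows "integral\<^sup>L sphere_measure g = real CARD('n) * (\<integral>x. indicator (cball 0 1) x * g (sgn x) \<partial>lborel)"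
proof -
  have meas: "(\<lambda>x. indicator A x * (c * g (sgn x))) \<in> borel_measurable borel"
    "(\<lambda>x. c * (indicator A x * g (sgn x))) \<in> borel_measurable borel" if "A \<in> sets borel" for c A
    using that by measurable
  let ?S = "restrict_space borel (sphere 0 1) :: (real^'n) measure"
  let ?D = "restrict_space lborel (cball 0 1 - {0}) :: (real^'n) measure"
  have sgn[measurable]: "sgn \<in> ?D \<rightarrow>\<^sub>M ?S"
    by (rule measurable_restrict_space2) (auto simp: space_restrict_space norm_sgn intro!: measurable_restrict_space1)
  have [measurable]: "g \<in> borel_measurable ?S" by (rule measurable_restrict_space1) simp
  have "integral\<^sup>L sphere_measure g = (\<integral>x. real CARD('n) * g (sgn x) \<partial>?D)"
    unfolding sphere_measure_eq_distr by (simp add: integral_distr integral_density)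
  also have "\<dots> = (\<integral>x. indicator (cball 0 1 - {0}) x * (real CARD('n) * g (sgn x)) \<partial>lborel)"
    by (subst integral_restrict_space) auto
  also have "\<dots> = (\<integral>x. real CARD('n) * (indicator (cball 0 1) x * g (sgn x)) \<partial>lborel)"
  proof (rule integral_cong_AE)
    show "AE x in lborel. indicator (cball 0 1 - {0}) x * (real CARD('n) * g (sgn x)) =
              real CARD('n) * (indicator (cball 0 1) x * g (sgn x))"
      using AE_lborel_singleton[of "0::real^'n"] by eventually_elim (auto simp: indicator_def)
  qed (simp_all add: meas)
  finally show ?thesis by simp
qed

lemma integral_powr_from_0:
  fixes a :: real
  assumes "a > 0"
  shows "(\<integral>x. indicator {0..1} x * x powr a \<partial>lborel) = 1 / (a + 1)"
proof -
  have i: "((\<lambda>x. x powr a) has_integral 1 / (a + 1)) {0..1}"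
    using has_integral_powr_from_0[of a 1] assms by simp
  have "set_integrable lborel {0..1} (\<lambda>x::real. x powr a)"
    using assms by (intro borel_integrable_atLeastAtMost' continuous_on_powr') (auto intro!: continuous_intros)
  from set_borel_integral_eq_integral(2)[OF this] i show ?thesis
    by (simp add: set_lebesgue_integral_def integral_unique)
qed

text \<open>Layer cake: integrate the indicator of \<open>\<tau> < |x|\<^sup>s\<close> over \<open>\<tau>\<close> and rescale the balls.\<close>

lemma integral_cball_homogeneous:
  fixes F :: "real^'n \<Rightarrow> real"
  assumes F: "continuous_on UNIV F" and s: "s \<ge> 0"
    and hom: "\<And>t x. t > 0 \<Longrightarrow> F (t *\<^sub>R x) = t powr s * F x"
  shows "(s + real CARD('n)) * (\<integral>x. indicator (cball 0 1) x * F x \<partial>lborel) = integral\<^sup>L sphere_measure F"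
proof -
  have [measurable]: "F \<in> borel_measurable borel" by (rule borel_measurable_continuous_onI[OF F])
  define d where "d = real CARD('n)"
  have d: "d > 0" by (simp add: d_def)
  let ?B = "cball 0 1 :: (real^'n) set"
  have [measurable]: "?B \<in> sets borel" by simp
  define G where "G x = F (sgn x)" for x
  have [measurable]: "G \<in> borel_measurable borel" unfolding G_def by measurable
  have FG: "F x = norm x powr s * G x" if "x \<noteq> 0" for x
    using hom[of "norm x" "sgn x"] that by (simp add: G_def sgn_div_norm)
  define K where "K = (\<integral>x. indicator ?B x * G x \<partial>lborel)"
  obtain M where M: "\<And>x. \<bar>G x\<bar> \<le> M"
  proof -
    have "bounded (F ` cball 0 1)" 
      by (intro compact_imp_bounded compact_continuous_image continuous_on_subset[OF F]) auto
    then obtain M where "\<And>x. x \<in> cball 0 1 \<Longrightarrow> \<bar>F x\<bar> \<le> M"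
      unfolding bounded_iff by force
    moreover have "sgn x \<in> cball 0 1" for x :: "real^'n" by (simp add: norm_sgn)
    ultimately have "\<bar>G x\<bar> \<le> M" for x unfolding G_def by blast
    with that show ?thesis by blast
  qed
  have iG: "integrable lborel (\<lambda>x. indicator ?B x * G x)"
    using integrableI_bounded_set_indicator[of ?B lborel G M] M emeasure_lborel_cball_finite[of "0::real^'n" 1] by simp
  have "(s + d) * (\<integral>x. indicator ?B x * F x \<partial>lborel) = d * K"
  proof (cases "s = 0")
    \<comment> \<open>With exponent 0 the level sets of \<open>norm x powr s\<close> are not balls,
      but F and G already agree away from the origin.\<close>
    case True
    have "(\<integral>x. indicator ?B x * F x \<partial>lborel) = K" unfolding K_def
    proof (rule integral_cong_AE)
      show "AE x in lborel. indicator ?B x * F x = indicator ?B x * G x"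
        using AE_lborel_singleton[of "0::real^'n"] by eventually_elim (auto simp: FG True)
    qed auto
    then show ?thesis by (simp add: True)
  next
    case False
    with s have s: "s > 0" by simp
    define H where "H x \<tau> = indicator ?B x * G x * (if 0 \<le> \<tau> \<and> \<tau> < norm x powr s then 1 else 0)" for x and \<tau> :: real
    have le1: "norm x powr s \<le> 1" if "norm x \<le> 1" for x :: "real^'n"
      using powr_mono2[of s "norm x" 1] that s by simp
    have iH: "integrable (lborel \<Otimes>\<^sub>M lborel) (\<lambda>(x, \<tau>). H x \<tau>)"
    proof (rule integrableI_bounded_set[where A = "?B \<times> {0..1}" and B = M])
      show "(\<lambda>(x, \<tau>). H x \<tau>) \<in> borel_measurable (lborel \<Otimes>\<^sub>M lborel)"
        unfolding H_def by measurable
      have "emeasure (lborel \<Otimes>\<^sub>M lborel) (?B \<times> {0..1::real}) = emeasure lborel ?B * emeasure lborel {0..1::real}"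
        by (rule lborel.emeasure_pair_measure_Times) auto
      then show "emeasure (lborel \<Otimes>\<^sub>M lborel) (?B \<times> {0..1::real}) < \<infinity>"
        using emeasure_lborel_cball_finite[of "0::real^'n" 1] by simp
      have "M \<ge> 0" using M[of 0] by linarith
      then show "AE x in lborel \<Otimes>\<^sub>M lborel. x \<in> ?B \<times> {0..1} \<longrightarrow> norm (case x of (x, \<tau>) \<Rightarrow> H x \<tau>) \<le> M"
        using M by (auto simp: H_def indicator_def)
      have "H x \<tau> = 0" if "(x, \<tau>) \<notin> ?B \<times> {0..1}" for x \<tau>
        using that le1[of x] by (auto simp: H_def indicator_def)
      then show "AE x in lborel \<Otimes>\<^sub>M lborel. x \<notin> ?B \<times> {0..1} \<longrightarrow> (case x of (x, \<tau>) \<Rightarrow> H x \<tau>) = 0"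
        by (intro AE_I2) (metis (no_types, lifting) case_prod_conv surj_pair)
    qed auto
    \<comment> \<open>For 0 < \<tau> < 1 the set is the shell between the radii
      \<open>\<tau> powr (1 / s)\<close> and 1. As G is constant on rays, the removed inner ball
      contributes K times the d-th power of its radius. The two end values are left out as a null
      set.\<close>
    have shell: "(\<integral>x. H x \<tau> \<partial>lborel) = indicator {0..1} \<tau> * ((1 - \<tau> powr (d / s)) * K)" if "\<tau> \<noteq> 0" "\<tau> \<noteq> 1" for \<tau>
    proof (cases "0 < \<tau> \<and> \<tau> < 1")
      case False
      with that have "H x \<tau> = 0" for x using le1[of x] by (auto simp: H_def indicator_def)
      with False that show ?thesis by (auto simp: indicator_def)
    next
      case True
      define r where "r = \<tau> powr (1 / s)"
      have [measurable]: "(cball 0 r :: (real^'n) set) \<in> sets borel" by simp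
      have r: "r > 0" "r < 1" using True s powr_less_mono2[of "1 / s" \<tau> 1] by (auto simp: r_def)
      have "\<tau> < norm x powr s \<longleftrightarrow> r < norm x" for x :: "real^'n"
      proof -
        have "\<tau> = r powr s" using True s by (simp add: r_def powr_powr)
        then show ?thesis
          using r s powr_less_mono2[of s r "norm x"] powr_mono2[of s "norm x" r] by (force simp: not_less[symmetric])
      qed
      then have "H x \<tau> = indicator ?B x * G x - indicator (cball 0 r) x * G x" for x
        using True r by (auto simp: H_def indicator_def)
      moreover have "integrable lborel (\<lambda>x. indicator (cball 0 r) x * G x)"
        using integrableI_bounded_set_indicator[of "cball 0 r" lborel G M] M emeasure_lborel_cball_finite[of "0::real^'n" r] by simp
      ultimately have "(\<integral>x. H x \<tau> \<partial>lborel) = K - (\<integral>x. indicator (cball 0 r) x * G x \<partial>lborel)"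
        using iG by (simp add: K_def)
      also have "(\<integral>x. indicator (cball 0 r) x * G x \<partial>lborel)
        = r ^ CARD('n) * (\<integral>x. indicator (cball 0 r) (r *\<^sub>R x) * G (r *\<^sub>R x) \<partial>lborel)"
        using r by (subst lborel_integral_scaleR[of r]) auto
      also have "(\<lambda>x. indicator (cball 0 r) (r *\<^sub>R x) * G (r *\<^sub>R x)) = (\<lambda>x. indicator ?B x * G x)"
        using r by (auto simp: indicator_def G_def sgn_scaleR fun_eq_iff)
      also have "r ^ CARD('n) = \<tau> powr (d / s)"
        using True by (simp add: r_def d_def powr_powr flip: powr_realpow)
      finally show ?thesis using True by (simp add: K_def algebra_simps)
    qed
    have slice: "(\<integral>\<tau>. H x \<tau> \<partial>lborel) = indicator ?B x * F x" if "x \<noteq> 0" for x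
    proof -
      have "(\<integral>\<tau>. H x \<tau> \<partial>lborel) = (\<integral>\<tau>. indicator ?B x * G x * indicator {0..<norm x powr s} \<tau> \<partial>lborel)"
        by (intro Bochner_Integration.integral_cong) (auto simp: H_def indicator_def)
      also have "\<dots> = indicator ?B x * G x * (norm x powr s)" by simp
      finally show ?thesis using FG[OF that] by simp
    qed
    have "(\<integral>x. indicator ?B x * F x \<partial>lborel) = (\<integral>x. (\<integral>\<tau>. H x \<tau> \<partial>lborel) \<partial>lborel)"
    proof (rule integral_cong_AE)
      show "AE x in lborel. indicator ?B x * F x = (\<integral>\<tau>. H x \<tau> \<partial>lborel)"
        using AE_lborel_singleton[of "0::real^'n"] by eventually_elim (simp add: slice)
      show "(\<lambda>x. \<integral>\<tau>. H x \<tau> \<partial>lborel) \<in> borel_measurable lborel"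
        unfolding H_def by measurable
    qed auto
    also have "\<dots> = (\<integral>\<tau>. (\<integral>x. H x \<tau> \<partial>lborel) \<partial>lborel)"
      by (rule lborel_pair.Fubini_integral[OF iH, symmetric])
    also have "\<dots> = (\<integral>\<tau>. indicator {0..1} \<tau> * ((1 - \<tau> powr (d / s)) * K) \<partial>lborel)"
    proof (rule integral_cong_AE)
      show "AE \<tau> in lborel. (\<integral>x. H x \<tau> \<partial>lborel) = indicator {0..1} \<tau> * ((1 - \<tau> powr (d / s)) * K)"
        using AE_lborel_singleton[of "0::real"] AE_lborel_singleton[of "1::real"] by eventually_elim (simp add: shell)
      show "(\<lambda>\<tau>. \<integral>x. H x \<tau> \<partial>lborel) \<in> borel_measurable lborel"
        unfolding H_def by measurable
    qed auto
    also have "\<dots> = (\<integral>\<tau>. K * (indicator {0..1} \<tau> * 1) - K * (indicator {0..1} \<tau> * \<tau> powr (d / s)) \<partial>lborel)"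
      by (intro Bochner_Integration.integral_cong) (auto simp: algebra_simps)
    also have "\<dots> = K - K * (1 / (d / s + 1))"
    proof -
      have "integrable lborel (\<lambda>\<tau>::real. indicator {0..1} \<tau> * \<tau> powr (d / s))"
      proof -
        have "continuous_on {0..1} (\<lambda>x::real. x powr (d / s))"
          using d s by (intro continuous_on_powr') (auto intro!: continuous_intros)
        from borel_integrable_atLeastAtMost'[OF this] show ?thesis by (simp add: set_integrable_def)
      qed
      then show ?thesis using integral_powr_from_0[of "d / s"] d s by (subst Bochner_Integration.integral_diff) auto
    qed
    finally show ?thesis using d s by (simp add: field_simps)
  qed
  moreover have "integral\<^sup>L sphere_measure F = d * K"
    by (simp add: integral_sphere_measure d_def K_def G_def)
  ultimately show ?thesis by (simp add: d_def)
qed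

section \<open>Integration by parts\<close>

lemma integrable_continuous_cball:
  fixes g :: "real^'n \<Rightarrow> real"
  assumes "continuous_on UNIV g" "\<And>x. norm x > r \<Longrightarrow> g x = 0"
  shows "integrable lborel g"
proof -
  have "integrable lborel (\<lambda>x. indicator (cball 0 r) x *\<^sub>R g x)"
    by (intro borel_integrable_compact continuous_on_subset[OF assms(1)]) auto
  also have "(\<lambda>x. indicator (cball 0 r) x *\<^sub>R g x) = g"
    using assms(2) by (auto simp: indicator_def fun_eq_iff)
  finally show ?thesis .
qed

text \<open>Difference quotients of g integrate to 0 by translation invariance. The mean value
  theorem bounds them by the maximum of |g'|, so dominated convergence carries this over to the
  derivative; the result stands in for the divergence theorem.\<close>

lemma integral_directional_derivative_eq_0:
  fixes g g' :: "real^'n \<Rightarrow> real"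
  assumes der: "\<And>x. ((\<lambda>t. g (x + t *\<^sub>R \<xi>)) has_real_derivative g' x) (at 0)"
    and cont: "continuous_on UNIV g" "continuous_on UNIV g'"
    and supp: "\<And>x. norm x > 1 \<Longrightarrow> g x = 0" "\<And>x. norm x > 1 \<Longrightarrow> g' x = 0"
  shows "integral\<^sup>L lborel g' = 0"
proof -
  have [measurable]: "g \<in> borel_measurable borel" "g' \<in> borel_measurable borel"
    by (auto intro: borel_measurable_continuous_onI cont)
  have ig: "integrable lborel g" by (rule integrable_continuous_cball[OF cont(1) supp(1)])
  obtain K where K: "\<And>x. \<bar>g' x\<bar> \<le> K" "K \<ge> 0"
  proof -
    have "bounded (g' ` cball 0 1)"
      by (intro compact_imp_bounded compact_continuous_image continuous_on_subset[OF cont(2)]) auto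
    then obtain M where M: "\<And>x. x \<in> cball 0 1 \<Longrightarrow> \<bar>g' x\<bar> \<le> M" unfolding bounded_iff by force
    have M0: "M \<ge> 0" using M[of 0] by simp
    have "\<bar>g' x\<bar> \<le> M" for x
      using M[of x] supp(2)[of x] M0 by (cases "norm x \<le> 1") auto
    with M0 that show ?thesis by blast
  qed
  have der': "((\<lambda>t. g (x + t *\<^sub>R \<xi>)) has_real_derivative g' (x + t *\<^sub>R \<xi>)) (at t)" for x t
    using der[of "x + t *\<^sub>R \<xi>"] DERIV_shift[of "\<lambda>t. g (x + t *\<^sub>R \<xi>)" "g' (x + t *\<^sub>R \<xi>)" 0 t]
    by (simp add: algebra_simps)
  \<comment> \<open>Steps of size at most 1 keep all difference quotients supported in the ball of
    radius \<open>1 + norm \<xi>\<close>.\<close>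
  define t where "t n = 1 / real (Suc n)" for n
  have t: "0 < t n" "t n \<le> 1" for n by (auto simp: t_def)
  have tl: "t \<longlonglongrightarrow> 0" unfolding t_def using LIMSEQ_inverse_real_of_nat by (simp add: inverse_eq_divide)
  define q where "q n x = (g (x + t n *\<^sub>R \<xi>) - g x) / t n" for n x
  have "(\<lambda>n. \<integral>x. q n x \<partial>lborel) \<longlonglongrightarrow> (\<integral>x. g' x \<partial>lborel)"
  proof (rule integral_dominated_convergence[where w = "\<lambda>x. K * indicator (cball 0 (1 + norm \<xi>)) x"])
    show "AE x in lborel. (\<lambda>n. q n x) \<longlonglongrightarrow> g' x"
    proof (rule AE_I2)
      fix x
      have "((\<lambda>s. (g (x + s *\<^sub>R \<xi>) - g x) / s) \<longlongrightarrow> g' x) (at 0)"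
        using der[of x] by (simp add: has_field_derivative_iff)
      moreover have "filterlim t (at 0) sequentially"
        using tl t(1) by (auto simp: filterlim_at intro!: always_eventually) (metis less_irrefl)
      ultimately show "(\<lambda>n. q n x) \<longlonglongrightarrow> g' x"
        unfolding q_def by (rule filterlim_compose)
    qed
    show "AE x in lborel. norm (q n x) \<le> K * indicator (cball 0 (1 + norm \<xi>)) x" for n
    proof (rule AE_I2)
      fix x
      show "norm (q n x) \<le> K * indicator (cball 0 (1 + norm \<xi>)) x"
      proof (cases "norm x \<le> 1 + norm \<xi>")
        case True
        obtain z where "g (x + t n *\<^sub>R \<xi>) - g (x + 0 *\<^sub>R \<xi>) = (t n - 0) * g' (x + z *\<^sub>R \<xi>)"
          using MVT2[OF t(1)[of n], of "\<lambda>t. g (x + t *\<^sub>R \<xi>)" "\<lambda>t. g' (x + t *\<^sub>R \<xi>)"] der' by blast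
        then have "q n x = g' (x + z *\<^sub>R \<xi>)" using t(1)[of n] by (simp add: q_def)
        with K True show ?thesis by simp
      next
        case False
        have "norm (t n *\<^sub>R \<xi>) \<le> norm \<xi>" using t[of n] by (simp add: mult_left_le_one_le)
        then have "norm (x + t n *\<^sub>R \<xi>) > 1"
          using False norm_triangle_ineq4[of "x + t n *\<^sub>R \<xi>" "t n *\<^sub>R \<xi>"] by simp
        moreover have "norm x > 1" using False norm_ge_zero[of \<xi>] by linarith
        ultimately show ?thesis using supp(1) K by (simp add: q_def indicator_def)
      qed
    qed
    show "integrable lborel (\<lambda>x::real^'n. K * indicator (cball 0 (1 + norm \<xi>)) x)"
      using emeasure_lborel_cball_finite[of "0::real^'n" "1 + norm \<xi>"]
      by (intro integrable_mult_right integrable_real_indicator) auto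
    show "q n \<in> borel_measurable lborel" for n unfolding q_def by measurable
  qed auto
  moreover have "(\<integral>x. q n x \<partial>lborel) = 0" for n
  proof -
    have "integrable lborel (\<lambda>x. g (x + t n *\<^sub>R \<xi>))"
    proof (rule integrable_continuous_cball[where r = "1 + norm \<xi>"])
      show "continuous_on UNIV (\<lambda>x. g (x + t n *\<^sub>R \<xi>))"
        by (rule continuous_on_compose2[OF cont(1)]) (auto intro!: continuous_intros)
      fix x :: "real^'n" assume "norm x > 1 + norm \<xi>"
      moreover have "norm (t n *\<^sub>R \<xi>) \<le> norm \<xi>" using t[of n] by (simp add: mult_left_le_one_le)
      ultimately show "g (x + t n *\<^sub>R \<xi>) = 0"
        using norm_triangle_ineq4[of "x + t n *\<^sub>R \<xi>" "t n *\<^sub>R \<xi>"] by (intro supp) simp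
    qed
    then show ?thesis
      unfolding q_def using ig by (simp add: lborel_integral_translation)
  qed
  ultimately have "(\<lambda>n::nat. 0) \<longlonglongrightarrow> (\<integral>x. g' x \<partial>lborel)" by simp
  then show ?thesis by (simp add: LIMSEQ_const_iff)
qed

lemma orthogonal_transformation_refl: "\<alpha> \<noteq> 0 \<Longrightarrow> orthogonal_transformation (refl \<alpha>)"
  by (simp add: orthogonal_transformation_def linear_refl inner_refl)

text \<open>Squaring removes the kink at 0, so the squared cut-off is continuously differentiable
  across the unit sphere.\<close>

lemma DERIV_max_0_power2:
  fixes x :: real
  shows "((\<lambda>t. (max 0 t)\<^sup>2) has_real_derivative 2 * max 0 x) (at x)"
proof (cases "x = 0")
  case True
  have "((\<lambda>h::real. (max 0 h)\<^sup>2 / h) \<longlongrightarrow> 0) (at 0)"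
  proof (rule Lim_null_comparison)
    show "\<forall>\<^sub>F h in at 0. norm ((max 0 h)\<^sup>2 / h) \<le> \<bar>h\<bar>"
      by (auto simp: eventually_at_filter max_def power2_eq_square intro!: always_eventually)
    show "((\<lambda>h::real. \<bar>h\<bar>) \<longlongrightarrow> 0) (at 0)" by (auto intro!: tendsto_eq_intros)
  qed
  then show ?thesis by (simp add: True has_field_derivative_iff)
next
  case False
  show ?thesis
  proof (cases "x > 0")
    case True
    have "((\<lambda>t. t\<^sup>2) has_real_derivative 2 * max 0 x) (at x)"
      using True by (auto intro!: derivative_eq_intros)
    then show ?thesis
      by (rule has_field_derivative_transform_within_open[where S = "{0<..}"]) (use True in auto)
  next
    case F: False
    have "((\<lambda>t. 0) has_real_derivative 2 * max 0 x) (at x)"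
      using F by auto
    then show ?thesis
      by (rule has_field_derivative_transform_within_open[where S = "{..<0}"]) (use False F in auto)
  qed
qed

context dunkl_setting
begin

section \<open>The weight, its regularisation and the cut-off\<close>

definition weight :: "real^'n \<Rightarrow> real" where
  "weight x = (h_kappa Rp \<kappa> x)\<^sup>2"

text \<open>The product of the powers \<open>((\<alpha> \<bullet> x)\<^sup>2 + \<epsilon> *
  (\<alpha> \<bullet> \<alpha>)) powr \<kappa> \<alpha>\<close>. The exponential form makes the
  logarithmic derivative a plain sum over the roots; for \<epsilon> > 0 no root hyperplane is
  singular, and invariance under the reflections is kept.\<close>

definition reg_weight :: "real \<Rightarrow> real^'n \<Rightarrow> real" where
  "reg_weight \<epsilon> x = exp (\<Sum>\<alpha>\<in>Rp. \<kappa> \<alpha> * ln ((\<alpha> \<bullet> x)\<^sup>2 + \<epsilon> * (\<alpha> \<bullet> \<alpha>)))"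

abbreviation gamma where "gamma \<equiv> \<Sum>\<alpha>\<in>Rp. \<kappa> \<alpha>"

lemma weight_eq: "weight x = (\<Prod>\<alpha>\<in>Rp. if \<kappa> \<alpha> = 0 then 1 else (\<alpha> \<bullet> x)\<^sup>2 powr \<kappa> \<alpha>)"
proof -
  have "(\<bar>u\<bar> powr k)\<^sup>2 = u\<^sup>2 powr k" for u k :: real
    by (simp add: power2_eq_square flip: powr_mult)
  then show ?thesis
    unfolding weight_def h_kappa_def prod_power_distrib by (intro prod.cong) auto
qed

lemma continuous_weight: "continuous_on UNIV weight"
  unfolding weight_eq[abs_def]
proof (intro continuous_on_prod)
  fix \<alpha> assume "\<alpha> \<in> Rp"
  then show "continuous_on UNIV (\<lambda>x. if \<kappa> \<alpha> = 0 then 1 else (\<alpha> \<bullet> x)\<^sup>2 powr \<kappa> \<alpha>)"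
  proof (cases "\<kappa> \<alpha> = 0")
    case False
    with kappa_nonneg[OF \<open>\<alpha> \<in> Rp\<close>] have "\<kappa> \<alpha> > 0" by simp
    then have "continuous_on UNIV (\<lambda>x. (\<alpha> \<bullet> x)\<^sup>2 powr \<kappa> \<alpha>)"
      by (intro continuous_on_powr') (auto intro!: continuous_intros)
    with False show ?thesis by simp
  qed simp
qed

lemma weight_refl: "\<beta> \<in> R \<Longrightarrow> weight (refl \<beta> x) = weight x"
proof -
  assume b: "\<beta> \<in> R"
  let ?F = "\<lambda>\<alpha>. if \<kappa> \<alpha> = 0 then 1 else (\<alpha> \<bullet> x)\<^sup>2 powr \<kappa> \<alpha>"
  have "weight (refl \<beta> x) = (\<Prod>\<alpha>\<in>Rp. ?F (refl \<beta> \<alpha>))"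
    unfolding weight_eq using Rp_subset b
    by (intro prod.cong refl) (auto simp: kappa_refl inner_refl_swap root_nonzero)
  also have "\<dots> = weight x" unfolding weight_eq by (rule prod_Rp_refl[OF b]) (auto simp: kappa_minus)
  finally show ?thesis .
qed

lemma weight_scale: "t > 0 \<Longrightarrow> weight (t *\<^sub>R x) = t powr (2 * gamma) * weight x"
proof -
  assume t: "t > 0"
  have "weight (t *\<^sub>R x) = (\<Prod>\<alpha>\<in>Rp. t powr (2 * \<kappa> \<alpha>) * (if \<kappa> \<alpha> = 0 then 1 else (\<alpha> \<bullet> x)\<^sup>2 powr \<kappa> \<alpha>))"
    unfolding weight_eq
  proof (intro prod.cong refl)
    fix \<alpha>
    have "t\<^sup>2 = t powr 2" using t by simp
    then have "(t\<^sup>2) powr \<kappa> \<alpha> = t powr (2 * \<kappa> \<alpha>)" by (simp only: powr_powr)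
    then show "(if \<kappa> \<alpha> = 0 then 1 else (\<alpha> \<bullet> t *\<^sub>R x)\<^sup>2 powr \<kappa> \<alpha>) = t powr (2 * \<kappa> \<alpha>) * (if \<kappa> \<alpha> = 0 then 1 else (\<alpha> \<bullet> x)\<^sup>2 powr \<kappa> \<alpha>)"
      using t by (simp add: power_mult_distrib powr_mult)
  qed
  also have "\<dots> = t powr (2 * gamma) * weight x"
    unfolding weight_eq prod.distrib using t finite_Rp by (simp add: powr_sum sum_distrib_left)
  finally show ?thesis .
qed

lemma weight_minus: "weight (- x) = weight x"
  by (simp add: weight_eq cong: if_cong)

lemma reg_weight_refl: "\<beta> \<in> R \<Longrightarrow> reg_weight \<epsilon> (refl \<beta> x) = reg_weight \<epsilon> x"
proof -
  assume b: "\<beta> \<in> R"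
  let ?F = "\<lambda>\<alpha>. \<kappa> \<alpha> * ln ((\<alpha> \<bullet> x)\<^sup>2 + \<epsilon> * (\<alpha> \<bullet> \<alpha>))"
  have "(\<Sum>\<alpha>\<in>Rp. \<kappa> \<alpha> * ln ((\<alpha> \<bullet> refl \<beta> x)\<^sup>2 + \<epsilon> * (\<alpha> \<bullet> \<alpha>))) = (\<Sum>\<alpha>\<in>Rp. ?F (refl \<beta> \<alpha>))"
    using Rp_subset b
    by (intro sum.cong refl) (auto simp: kappa_refl inner_refl inner_refl_swap[of \<beta> _ x] root_nonzero)
  also have "\<dots> = (\<Sum>\<alpha>\<in>Rp. ?F \<alpha>)" by (rule sum_Rp_refl[OF b]) (auto simp: kappa_minus)
  finally show ?thesis by (simp add: reg_weight_def)
qed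

lemma reg_pos: "\<alpha> \<in> Rp \<Longrightarrow> \<epsilon> > 0 \<Longrightarrow> (\<alpha> \<bullet> x)\<^sup>2 + \<epsilon> * (\<alpha> \<bullet> \<alpha>) > 0"
  using Rp_nonzero by (simp add: add_nonneg_pos)

lemma reg_nonzero: "\<alpha> \<in> Rp \<Longrightarrow> \<epsilon> > 0 \<Longrightarrow> (\<alpha> \<bullet> x)\<^sup>2 + \<epsilon> * (\<alpha> \<bullet> \<alpha>) \<noteq> 0"
  using reg_pos[of \<alpha> \<epsilon> x] by simp

lemma continuous_reg_weight:
  assumes "\<epsilon> > 0"
  shows "continuous_on UNIV (reg_weight \<epsilon>)"
  unfolding reg_weight_def[abs_def] using reg_nonzero[OF _ assms]
  by (intro continuous_intros) auto

lemma DERIV_reg_weight: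
  assumes "\<epsilon> > 0"
  shows "((\<lambda>t. reg_weight \<epsilon> (x + t *\<^sub>R \<xi>)) has_real_derivative
    (\<Sum>\<alpha>\<in>Rp. 2 * \<kappa> \<alpha> * (\<alpha> \<bullet> \<xi>) * ((\<alpha> \<bullet> x) / ((\<alpha> \<bullet> x)\<^sup>2 + \<epsilon> * (\<alpha> \<bullet> \<alpha>)))) * reg_weight \<epsilon> x) (at 0)"
proof -
  have "((\<lambda>t. \<Sum>\<alpha>\<in>Rp. \<kappa> \<alpha> * ln ((\<alpha> \<bullet> (x + t *\<^sub>R \<xi>))\<^sup>2 + \<epsilon> * (\<alpha> \<bullet> \<alpha>))) has_real_derivative
     (\<Sum>\<alpha>\<in>Rp. 2 * \<kappa> \<alpha> * (\<alpha> \<bullet> \<xi>) * ((\<alpha> \<bullet> x) / ((\<alpha> \<bullet> x)\<^sup>2 + \<epsilon> * (\<alpha> \<bullet> \<alpha>))))) (at 0)"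
    using reg_pos[OF _ assms]
    by (intro DERIV_sum) (auto intro!: derivative_eq_intros simp: inner_add_right)
  from DERIV_chain2[OF DERIV_exp this] show ?thesis by (simp add: reg_weight_def mult.commute)
qed

lemma reg_weight_mono: 
  assumes "0 < \<epsilon>" "\<epsilon> \<le> 1"
  shows "reg_weight \<epsilon> x \<le> reg_weight 1 x"
  unfolding reg_weight_def exp_le_cancel_iff
proof (intro sum_mono mult_left_mono)
  fix \<alpha> assume a: "\<alpha> \<in> Rp"
  show "ln ((\<alpha> \<bullet> x)\<^sup>2 + \<epsilon> * (\<alpha> \<bullet> \<alpha>)) \<le> ln ((\<alpha> \<bullet> x)\<^sup>2 + 1 * (\<alpha> \<bullet> \<alpha>))"
    using reg_pos[OF a assms(1), of x] reg_pos[OF a, of 1 x] assms(2) mult_right_mono[OF assms(2), of "\<alpha> \<bullet> \<alpha>"] by simp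
qed (rule kappa_nonneg)

lemma reg_weight_limit:
  assumes "\<And>n. \<epsilon> n > 0" "\<epsilon> \<longlonglongrightarrow> 0"
  shows "(\<lambda>n. reg_weight (\<epsilon> n) x) \<longlonglongrightarrow> weight x"
proof -
  have e: "reg_weight (\<epsilon> n) x = (\<Prod>\<alpha>\<in>Rp. ((\<alpha> \<bullet> x)\<^sup>2 + \<epsilon> n * (\<alpha> \<bullet> \<alpha>)) powr \<kappa> \<alpha>)" for n
    unfolding reg_weight_def exp_sum[OF finite_Rp]
    by (intro prod.cong refl) (auto simp: powr_def reg_nonzero[OF _ assms(1)])
  show ?thesis
    unfolding e weight_eq
  proof (intro tendsto_prod)
    fix \<alpha> assume a: "\<alpha> \<in> Rp"
    have l: "(\<lambda>n. (\<alpha> \<bullet> x)\<^sup>2 + \<epsilon> n * (\<alpha> \<bullet> \<alpha>)) \<longlonglongrightarrow> (\<alpha> \<bullet> x)\<^sup>2 + 0 * (\<alpha> \<bullet> \<alpha>)"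
      by (intro tendsto_intros assms)
    show "(\<lambda>n. ((\<alpha> \<bullet> x)\<^sup>2 + \<epsilon> n * (\<alpha> \<bullet> \<alpha>)) powr \<kappa> \<alpha>) \<longlonglongrightarrow> (if \<kappa> \<alpha> = 0 then 1 else (\<alpha> \<bullet> x)\<^sup>2 powr \<kappa> \<alpha>)"
    proof (cases "\<kappa> \<alpha> = 0")
      \<comment> \<open>The regularised base is positive, so its power 0 is 1, whereas
        \<open>0 powr 0\<close> is 0; the limit therefore matches the convention in
        \<open>h_kappa\<close>.\<close>
      case True
      have "((\<alpha> \<bullet> x)\<^sup>2 + \<epsilon> n * (\<alpha> \<bullet> \<alpha>)) powr \<kappa> \<alpha> = 1" for n
        using reg_pos[OF a assms(1), of x n] True by simp
      then show ?thesis using True by simp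
    next
      case False
      with kappa_nonneg[OF a] have "\<kappa> \<alpha> > 0" by simp
      moreover have "\<forall>\<^sub>F n in sequentially. (\<alpha> \<bullet> x)\<^sup>2 + \<epsilon> n * (\<alpha> \<bullet> \<alpha>) \<ge> 0"
        using reg_pos[OF a assms(1)] by (auto intro!: always_eventually less_imp_le)
      ultimately show ?thesis using tendsto_powr'[OF l tendsto_const, of "\<kappa> \<alpha>"] False by simp
    qed
  qed
qed

text \<open>Its square is continuously differentiable with support in the unit ball, and on the ball
  the square and its gradient are polynomial, so integration by parts yields only integrals of
  homogeneous functions.\<close>

definition cutoff :: "real^'n \<Rightarrow> real" where
  "cutoff x = max 0 (1 - x \<bullet> x)"

lemma cutoff_eq_0: "norm x > 1 \<Longrightarrow> cutoff x = 0"
  by (simp add: cutoff_def flip: power2_norm_eq_inner)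

lemma cutoff_le_1: "0 \<le> cutoff x" "cutoff x \<le> 1"
  by (simp_all add: cutoff_def)

lemma continuous_cutoff: "continuous_on UNIV cutoff"
  unfolding cutoff_def[abs_def] by (intro continuous_intros)

lemma cutoff_refl: "\<alpha> \<noteq> 0 \<Longrightarrow> cutoff (refl \<alpha> x) = cutoff x"
  by (simp add: cutoff_def inner_refl)

lemma DERIV_cutoff: "((\<lambda>t. (cutoff (x + t *\<^sub>R \<xi>))\<^sup>2) has_real_derivative - 4 * (\<xi> \<bullet> x) * cutoff x) (at 0)"
proof -
  have "((\<lambda>t. 1 - (x + t *\<^sub>R \<xi>) \<bullet> (x + t *\<^sub>R \<xi>)) has_real_derivative - 2 * (\<xi> \<bullet> x)) (at 0)"
    by (auto intro!: derivative_eq_intros simp: inner_commute algebra_simps)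
  from DERIV_chain2[OF DERIV_max_0_power2 this] show ?thesis by (simp add: cutoff_def mult.commute mult.left_commute)
qed

lemma continuous_ddir: "hpoly l f \<Longrightarrow> continuous_on UNIV (ddir \<xi> f)"
  using hpoly_ddir[of l f \<xi>] hpoly_continuous[of "l - 1" "ddir \<xi> f"] by (cases "l = 0") auto

lemma continuous_diffquot: "hpoly l f \<Longrightarrow> \<alpha> \<noteq> 0 \<Longrightarrow> continuous_on UNIV (diffquot \<alpha> f)"
  using hpoly_diffquot[of \<alpha> l f] hpoly_continuous[of "l - 1" "diffquot \<alpha> f"] by (cases "l = 0") auto

text \<open>Differentiating the weight in f * cutoff^2 * weight gives terms with f <\<alpha>,x> /
  (<\<alpha>,x>^2 + \<epsilon> |\<alpha>|^2). Averaging each with its reflected copy replaces f by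
  half of f - f(r x), that is, by <\<alpha>,x> times half the divided difference. This is the
  difference part of the Dunkl operator, damped by a ratio between 0 and 1.\<close>

lemma integral_reg_by_parts:
  assumes f: "hpoly l f" and e: "\<epsilon> > 0"
  shows "(\<integral>x. (ddir \<xi> f x * (cutoff x)\<^sup>2 - 4 * (\<xi> \<bullet> x) * f x * cutoff x
      + (\<Sum>\<alpha>\<in>Rp. \<kappa> \<alpha> * (\<alpha> \<bullet> \<xi>) * (diffquot \<alpha> f x * ((\<alpha> \<bullet> x)\<^sup>2 / ((\<alpha> \<bullet> x)\<^sup>2 + \<epsilon> * (\<alpha> \<bullet> \<alpha>)))) * (cutoff x)\<^sup>2))
      * reg_weight \<epsilon> x \<partial>lborel) = 0"
proof -
  let ?V = "reg_weight \<epsilon>"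
  note cont = hpoly_continuous[OF f] continuous_ddir[OF f] continuous_cutoff continuous_reg_weight[OF e]
  define c where "c \<alpha> x = (\<alpha> \<bullet> x) / ((\<alpha> \<bullet> x)\<^sup>2 + \<epsilon> * (\<alpha> \<bullet> \<alpha>))" for \<alpha> x :: "real^'n"
  define A where "A x = (ddir \<xi> f x * (cutoff x)\<^sup>2 - 4 * (\<xi> \<bullet> x) * f x * cutoff x) * ?V x" for x
  define T where "T \<alpha> x = f x * (cutoff x)\<^sup>2 * c \<alpha> x * ?V x" for \<alpha> x
  define P where "P \<alpha> x = diffquot \<alpha> f x * ((\<alpha> \<bullet> x)\<^sup>2 / ((\<alpha> \<bullet> x)\<^sup>2 + \<epsilon> * (\<alpha> \<bullet> \<alpha>))) * (cutoff x)\<^sup>2 * ?V x" for \<alpha> x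
  have cA: "continuous_on UNIV A" unfolding A_def by (intro continuous_intros cont)
  have cT: "continuous_on UNIV (T \<alpha>)" if "\<alpha> \<in> Rp" for \<alpha>
    unfolding T_def c_def using reg_nonzero[OF that e] by (intro continuous_intros cont) auto
  have cP: "continuous_on UNIV (P \<alpha>)" if "\<alpha> \<in> Rp" for \<alpha>
    unfolding P_def using reg_nonzero[OF that e] 
    by (intro continuous_intros cont continuous_diffquot[OF f Rp_nonzero[OF that]]) auto
  have iA: "integrable lborel A"
    by (rule integrable_continuous_cball[OF cA, of 1]) (auto simp: A_def cutoff_eq_0)
  have iT: "integrable lborel (T \<alpha>)" if "\<alpha> \<in> Rp" for \<alpha>
    by (rule integrable_continuous_cball[OF cT[OF that], of 1]) (auto simp: T_def cutoff_eq_0)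
  have iP: "integrable lborel (P \<alpha>)" if "\<alpha> \<in> Rp" for \<alpha>
    by (rule integrable_continuous_cball[OF cP[OF that], of 1]) (auto simp: P_def cutoff_eq_0)
  have "integral\<^sup>L lborel (\<lambda>x. A x + (\<Sum>\<alpha>\<in>Rp. 2 * \<kappa> \<alpha> * (\<alpha> \<bullet> \<xi>) * T \<alpha> x)) = 0"
  proof (rule integral_directional_derivative_eq_0[where g = "\<lambda>x. f x * (cutoff x)\<^sup>2 * ?V x" and \<xi> = \<xi>])
    fix x
    have "((\<lambda>t. f (x + t *\<^sub>R \<xi>) * (cutoff (x + t *\<^sub>R \<xi>))\<^sup>2 * ?V (x + t *\<^sub>R \<xi>)) has_real_derivative
      (ddir \<xi> f x * (cutoff x)\<^sup>2 + (- 4 * (\<xi> \<bullet> x) * cutoff x) * f x) * ?V x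
      + (\<Sum>\<alpha>\<in>Rp. 2 * \<kappa> \<alpha> * (\<alpha> \<bullet> \<xi>) * c \<alpha> x) * ?V x * (f x * (cutoff x)\<^sup>2)) (at 0)"
      using DERIV_mult[OF DERIV_mult[OF DERIV_hpoly_line[OF f] DERIV_cutoff] DERIV_reg_weight[OF e], of x \<xi> x \<xi> x \<xi>]
      by (simp add: c_def)
    also have "(ddir \<xi> f x * (cutoff x)\<^sup>2 + (- 4 * (\<xi> \<bullet> x) * cutoff x) * f x) * ?V x
      + (\<Sum>\<alpha>\<in>Rp. 2 * \<kappa> \<alpha> * (\<alpha> \<bullet> \<xi>) * c \<alpha> x) * ?V x * (f x * (cutoff x)\<^sup>2)
      = A x + (\<Sum>\<alpha>\<in>Rp. 2 * \<kappa> \<alpha> * (\<alpha> \<bullet> \<xi>) * T \<alpha> x)"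
      by (simp add: A_def T_def sum_distrib_right) (simp add: algebra_simps)
    finally show "((\<lambda>t. f (x + t *\<^sub>R \<xi>) * (cutoff (x + t *\<^sub>R \<xi>))\<^sup>2 * ?V (x + t *\<^sub>R \<xi>)) has_real_derivative
      A x + (\<Sum>\<alpha>\<in>Rp. 2 * \<kappa> \<alpha> * (\<alpha> \<bullet> \<xi>) * T \<alpha> x)) (at 0)" .
  next
    show "continuous_on UNIV (\<lambda>x. f x * (cutoff x)\<^sup>2 * ?V x)" by (intro continuous_intros cont)
    show "continuous_on UNIV (\<lambda>x. A x + (\<Sum>\<alpha>\<in>Rp. 2 * \<kappa> \<alpha> * (\<alpha> \<bullet> \<xi>) * T \<alpha> x))"
      by (intro continuous_intros cA cT)
  qed (auto simp: cutoff_eq_0 A_def T_def)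
  then have 1: "integral\<^sup>L lborel A + (\<Sum>\<alpha>\<in>Rp. 2 * \<kappa> \<alpha> * (\<alpha> \<bullet> \<xi>) * integral\<^sup>L lborel (T \<alpha>)) = 0"
    using iA iT by simp
  \<comment> \<open>Cut-off and regularised weight are invariant under the reflection and
    \<open>c \<alpha>\<close> is odd, so \<open>T \<alpha>\<close> and its reflected copy add up to
    \<open>P \<alpha>\<close>.\<close>
  have 2: "2 * integral\<^sup>L lborel (T \<alpha>) = integral\<^sup>L lborel (P \<alpha>)" if a: "\<alpha> \<in> Rp" for \<alpha>
  proof -
    have a0: "\<alpha> \<noteq> 0" and aR: "\<alpha> \<in> R" using a Rp_nonzero Rp_subset by auto
    have "\<alpha> \<bullet> refl \<alpha> x = - (\<alpha> \<bullet> x)" for x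
      using inner_refl_swap[OF a0, of \<alpha> x] by (simp add: refl_self a0)
    then have TP: "T \<alpha> x + T \<alpha> (refl \<alpha> x) = P \<alpha> x" for x
      using inner_mult_diffquot[of \<alpha> x f]
      by (simp add: T_def P_def c_def cutoff_refl[OF a0] reg_weight_refl[OF aR] power2_eq_square[of "\<alpha> \<bullet> x"] flip: ring_distribs diff_divide_distrib)
        (simp add: algebra_simps diff_divide_distrib)
    have m: "T \<alpha> \<in> borel_measurable borel" by (intro borel_measurable_continuous_onI cT a)
    have "integral\<^sup>L lborel (P \<alpha>) = (\<integral>x. T \<alpha> x + T \<alpha> (refl \<alpha> x) \<partial>lborel)" by (simp add: TP)
    also have "\<dots> = integral\<^sup>L lborel (T \<alpha>) + (\<integral>x. T \<alpha> (refl \<alpha> x) \<partial>lborel)"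
    proof (rule Bochner_Integration.integral_add[OF iT[OF a]])
      have "integrable lborel (\<lambda>x. P \<alpha> x - T \<alpha> x)" using iP iT a by simp
      then show "integrable lborel (\<lambda>x. T \<alpha> (refl \<alpha> x))" by (simp add: TP[symmetric])
    qed
    also have "(\<integral>x. T \<alpha> (refl \<alpha> x) \<partial>lborel) = integral\<^sup>L lborel (T \<alpha>)"
      by (rule lborel_integral_orthogonal[OF orthogonal_transformation_refl[OF a0] m])
    finally show ?thesis by simp
  qed
  have "(\<lambda>x. (ddir \<xi> f x * (cutoff x)\<^sup>2 - 4 * (\<xi> \<bullet> x) * f x * cutoff x
      + (\<Sum>\<alpha>\<in>Rp. \<kappa> \<alpha> * (\<alpha> \<bullet> \<xi>) * (diffquot \<alpha> f x * ((\<alpha> \<bullet> x)\<^sup>2 / ((\<alpha> \<bullet> x)\<^sup>2 + \<epsilon> * (\<alpha> \<bullet> \<alpha>)))) * (cutoff x)\<^sup>2))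
      * ?V x) = (\<lambda>x. A x + (\<Sum>\<alpha>\<in>Rp. \<kappa> \<alpha> * (\<alpha> \<bullet> \<xi>) * P \<alpha> x))"
    by (simp add: fun_eq_iff A_def P_def distrib_right sum_distrib_right mult.assoc)
  moreover have "(\<integral>x. A x + (\<Sum>\<alpha>\<in>Rp. \<kappa> \<alpha> * (\<alpha> \<bullet> \<xi>) * P \<alpha> x) \<partial>lborel)
     = integral\<^sup>L lborel A + (\<Sum>\<alpha>\<in>Rp. \<kappa> \<alpha> * (\<alpha> \<bullet> \<xi>) * integral\<^sup>L lborel (P \<alpha>))"
    using iA iP by simp
  moreover have "\<dots> = integral\<^sup>L lborel A + (\<Sum>\<alpha>\<in>Rp. 2 * \<kappa> \<alpha> * (\<alpha> \<bullet> \<xi>) * integral\<^sup>L lborel (T \<alpha>))"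
    by (intro arg_cong2[where f = "(+)"] sum.cong refl) (simp add: 2[symmetric])
  ultimately show ?thesis using 1 by simp
qed

text \<open>Dominated convergence as \<epsilon> tends to 0: the ratios and the cut-off lie in [0,1],
  and \<open>reg_weight 1\<close> dominates all the regularised weights.\<close>

lemma integral_dunkl_by_parts:
  assumes f: "hpoly l f"
  shows "(\<integral>x. (\<D> \<xi> f x * (cutoff x)\<^sup>2 - 4 * (\<xi> \<bullet> x) * f x * cutoff x) * weight x \<partial>lborel) = 0"
proof -
  define \<epsilon> where "\<epsilon> n = 1 / real (Suc n)" for n
  have e: "\<epsilon> n > 0" "\<epsilon> n \<le> 1" for n by (auto simp: \<epsilon>_def)
  have el: "\<epsilon> \<longlonglongrightarrow> 0" unfolding \<epsilon>_def using LIMSEQ_inverse_real_of_nat by (simp add: inverse_eq_divide)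
  define ratio where "ratio \<alpha> n x = (\<alpha> \<bullet> x)\<^sup>2 / ((\<alpha> \<bullet> x)\<^sup>2 + \<epsilon> n * (\<alpha> \<bullet> \<alpha>))" for \<alpha> n and x :: "real^'n"
  have ratio: "0 \<le> ratio \<alpha> n x" "ratio \<alpha> n x \<le> 1" if "\<alpha> \<in> Rp" for \<alpha> n x
    using reg_pos[OF that e(1), of x n] e(1)[of n] by (auto simp: ratio_def divide_simps)
  define q where "q n x = (ddir \<xi> f x * (cutoff x)\<^sup>2 - 4 * (\<xi> \<bullet> x) * f x * cutoff x
      + (\<Sum>\<alpha>\<in>Rp. \<kappa> \<alpha> * (\<alpha> \<bullet> \<xi>) * (diffquot \<alpha> f x * ratio \<alpha> n x) * (cutoff x)\<^sup>2))
      * reg_weight (\<epsilon> n) x" for n x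
  define w where "w x = (\<bar>ddir \<xi> f x\<bar> + \<bar>4 * (\<xi> \<bullet> x) * f x\<bar>
      + (\<Sum>\<alpha>\<in>Rp. \<bar>\<kappa> \<alpha> * (\<alpha> \<bullet> \<xi>) * diffquot \<alpha> f x\<bar>)) * reg_weight 1 x" for x
  note cont = hpoly_continuous[OF f] continuous_ddir[OF f] continuous_cutoff continuous_diffquot[OF f Rp_nonzero] continuous_weight
  have cw: "continuous_on UNIV w" unfolding w_def by (intro continuous_intros cont continuous_reg_weight) auto
  have "(\<lambda>n. \<integral>x. q n x \<partial>lborel) \<longlonglongrightarrow> (\<integral>x. (\<D> \<xi> f x * (cutoff x)\<^sup>2 - 4 * (\<xi> \<bullet> x) * f x * cutoff x) * weight x \<partial>lborel)"
  proof (rule integral_dominated_convergence[where w = "\<lambda>x. indicator (cball 0 1) x *\<^sub>R w x"])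
    show "(\<lambda>x. (\<D> \<xi> f x * (cutoff x)\<^sup>2 - 4 * (\<xi> \<bullet> x) * f x * cutoff x) * weight x) \<in> borel_measurable lborel"
      unfolding dunkl_diffquot measurable_lborel2 by (intro borel_measurable_continuous_onI continuous_intros cont)
    show "q n \<in> borel_measurable lborel" for n
      unfolding q_def ratio_def measurable_lborel2 using reg_nonzero[OF _ e(1)]
      by (intro borel_measurable_continuous_onI continuous_intros cont continuous_reg_weight e) auto
    show "integrable lborel (\<lambda>x. indicator (cball 0 1) x *\<^sub>R w x)"
      by (intro borel_integrable_compact continuous_on_subset[OF cw]) auto
    show "AE x in lborel. (\<lambda>n. q n x) \<longlonglongrightarrow> (\<D> \<xi> f x * (cutoff x)\<^sup>2 - 4 * (\<xi> \<bullet> x) * f x * cutoff x) * weight x"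
    proof (rule AE_I2)
      fix x
      note rl = reg_weight_limit[OF e(1) el, of x]
      have summand: "(\<lambda>n. \<kappa> \<alpha> * (\<alpha> \<bullet> \<xi>) * (diffquot \<alpha> f x * ratio \<alpha> n x) * (cutoff x)\<^sup>2 * reg_weight (\<epsilon> n) x)
        \<longlonglongrightarrow> \<kappa> \<alpha> * (\<alpha> \<bullet> \<xi>) * diffquot \<alpha> f x * (cutoff x)\<^sup>2 * weight x" if a: "\<alpha> \<in> Rp" for \<alpha>
      proof (cases "\<alpha> \<bullet> x = 0")
        case True
        \<comment> \<open>On the hyperplane the ratio is constantly 0 instead of tending to 1. The
          limit is still correct, since either the coefficient or the weight is 0 there.\<close>
        have "\<kappa> \<alpha> = 0 \<or> weight x = 0"
          using True a finite_Rp by (auto simp: weight_eq intro!: bexI[of _ \<alpha>])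
        then show ?thesis using True by (auto simp: ratio_def)
      next
        case False
        have "(\<lambda>n. ratio \<alpha> n x) \<longlonglongrightarrow> (\<alpha> \<bullet> x)\<^sup>2 / ((\<alpha> \<bullet> x)\<^sup>2 + 0 * (\<alpha> \<bullet> \<alpha>))"
          unfolding ratio_def using False by (intro tendsto_intros el) auto
        then have "(\<lambda>n. ratio \<alpha> n x) \<longlonglongrightarrow> 1" using False by simp
        then have "(\<lambda>n. \<kappa> \<alpha> * (\<alpha> \<bullet> \<xi>) * (diffquot \<alpha> f x * ratio \<alpha> n x) * (cutoff x)\<^sup>2 * reg_weight (\<epsilon> n) x)
          \<longlonglongrightarrow> \<kappa> \<alpha> * (\<alpha> \<bullet> \<xi>) * (diffquot \<alpha> f x * 1) * (cutoff x)\<^sup>2 * weight x"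
          by (intro tendsto_intros rl)
        then show ?thesis by simp
      qed
      have "(\<lambda>n. (ddir \<xi> f x * (cutoff x)\<^sup>2 - 4 * (\<xi> \<bullet> x) * f x * cutoff x) * reg_weight (\<epsilon> n) x
        + (\<Sum>\<alpha>\<in>Rp. \<kappa> \<alpha> * (\<alpha> \<bullet> \<xi>) * (diffquot \<alpha> f x * ratio \<alpha> n x) * (cutoff x)\<^sup>2 * reg_weight (\<epsilon> n) x))
        \<longlonglongrightarrow> (ddir \<xi> f x * (cutoff x)\<^sup>2 - 4 * (\<xi> \<bullet> x) * f x * cutoff x) * weight x
        + (\<Sum>\<alpha>\<in>Rp. \<kappa> \<alpha> * (\<alpha> \<bullet> \<xi>) * diffquot \<alpha> f x * (cutoff x)\<^sup>2 * weight x)"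
        by (intro tendsto_intros rl summand)
      moreover have "(ddir \<xi> f x * (cutoff x)\<^sup>2 - 4 * (\<xi> \<bullet> x) * f x * cutoff x) * weight x
        + (\<Sum>\<alpha>\<in>Rp. \<kappa> \<alpha> * (\<alpha> \<bullet> \<xi>) * diffquot \<alpha> f x * (cutoff x)\<^sup>2 * weight x)
        = (\<D> \<xi> f x * (cutoff x)\<^sup>2 - 4 * (\<xi> \<bullet> x) * f x * cutoff x) * weight x"
        by (simp add: dunkl_diffquot sum_distrib_right ring_distribs)
      ultimately show "(\<lambda>n. q n x) \<longlonglongrightarrow> (\<D> \<xi> f x * (cutoff x)\<^sup>2 - 4 * (\<xi> \<bullet> x) * f x * cutoff x) * weight x"
        by (simp add: q_def distrib_right sum_distrib_right)
    qed
    show "AE x in lborel. norm (q n x) \<le> indicator (cball 0 1) x *\<^sub>R w x" for n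
    proof (rule AE_I2)
      fix x
      show "norm (q n x) \<le> indicator (cball 0 1) x *\<^sub>R w x"
      proof (cases "norm x \<le> 1")
        case False
        then have "q n x = 0" by (simp add: q_def cutoff_eq_0)
        then show ?thesis using False by simp
      next
        case True
        note c = cutoff_le_1[of x]
        have c2: "0 \<le> (cutoff x)\<^sup>2" "(cutoff x)\<^sup>2 \<le> 1" using c by (auto simp: power_le_one)
        have b: "\<bar>a * s\<bar> \<le> \<bar>a\<bar>" if "0 \<le> s" "s \<le> 1" for a s :: real
          using that by (simp add: abs_mult mult_left_le)
        have "\<bar>\<kappa> \<alpha> * (\<alpha> \<bullet> \<xi>) * (diffquot \<alpha> f x * ratio \<alpha> n x) * (cutoff x)\<^sup>2\<bar> \<le> \<bar>\<kappa> \<alpha> * (\<alpha> \<bullet> \<xi>) * diffquot \<alpha> f x\<bar>" if "\<alpha> \<in> Rp" for \<alpha>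
          using order_trans[OF b[OF c2] b[OF ratio[OF that]], of "\<kappa> \<alpha> * (\<alpha> \<bullet> \<xi>) * diffquot \<alpha> f x" n x]
          by (simp add: mult.assoc)
        then have "\<bar>\<Sum>\<alpha>\<in>Rp. \<kappa> \<alpha> * (\<alpha> \<bullet> \<xi>) * (diffquot \<alpha> f x * ratio \<alpha> n x) * (cutoff x)\<^sup>2\<bar>
          \<le> (\<Sum>\<alpha>\<in>Rp. \<bar>\<kappa> \<alpha> * (\<alpha> \<bullet> \<xi>) * diffquot \<alpha> f x\<bar>)"
          by (intro order_trans[OF sum_abs] sum_mono)
        moreover have "\<bar>ddir \<xi> f x * (cutoff x)\<^sup>2\<bar> \<le> \<bar>ddir \<xi> f x\<bar>" by (rule b[OF c2])
        moreover have "\<bar>4 * (\<xi> \<bullet> x) * f x * cutoff x\<bar> \<le> \<bar>4 * (\<xi> \<bullet> x) * f x\<bar>" by (rule b[OF c])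
        ultimately have "\<bar>ddir \<xi> f x * (cutoff x)\<^sup>2 - 4 * (\<xi> \<bullet> x) * f x * cutoff x
          + (\<Sum>\<alpha>\<in>Rp. \<kappa> \<alpha> * (\<alpha> \<bullet> \<xi>) * (diffquot \<alpha> f x * ratio \<alpha> n x) * (cutoff x)\<^sup>2)\<bar>
          \<le> \<bar>ddir \<xi> f x\<bar> + \<bar>4 * (\<xi> \<bullet> x) * f x\<bar> + (\<Sum>\<alpha>\<in>Rp. \<bar>\<kappa> \<alpha> * (\<alpha> \<bullet> \<xi>) * diffquot \<alpha> f x\<bar>)"
          by linarith
        then have "\<bar>q n x\<bar> \<le> w x"
          unfolding q_def w_def abs_mult
          using reg_weight_mono[OF e, of n x] by (intro mult_mono) (auto simp: reg_weight_def)
        then show ?thesis using True by simp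
      qed
    qed
  qed
  moreover have "(\<integral>x. q n x \<partial>lborel) = 0" for n
    using integral_reg_by_parts[OF f e(1)] by (simp add: q_def ratio_def)
  ultimately show ?thesis by (simp add: LIMSEQ_const_iff)
qed

section \<open>The spherical functional\<close>

definition sphere_int :: "(real^'n \<Rightarrow> real) \<Rightarrow> real" where
  "sphere_int f = integral\<^sup>L sphere_measure (\<lambda>y. f y * weight y)"

definition ball_int :: "(real^'n \<Rightarrow> real) \<Rightarrow> real" where
  "ball_int f = (\<integral>x. indicator (cball 0 1) x * (f x * weight x) \<partial>lborel)"

text \<open>The homogeneous dimension: dilation by t scales the measure with density
  \<open>weight\<close> by t to this power.\<close>

abbreviation hdim where "hdim \<equiv> 2 * gamma + real CARD('n)"

lemma gamma_nonneg: "gamma \<ge> 0"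
  by (intro sum_nonneg kappa_nonneg)

lemma hdim_ge_1: "hdim \<ge> 1"
proof -
  have "real CARD('n) \<ge> 1" using zero_less_card_finite[where 'a = 'n] by linarith
  with gamma_nonneg show ?thesis by linarith
qed

lemma lambda_kappa_hdim: "2 * lambda_kappa Rp \<kappa> + 2 = hdim"
  by (simp add: lambda_kappa_def)

lemma integrable_ball:
  assumes "continuous_on UNIV f"
  shows "integrable lborel (\<lambda>x. indicator (cball 0 1) x * (f x * weight x))"
proof -
  have "continuous_on (cball 0 1) (\<lambda>x. f x * weight x)"
    by (intro continuous_intros continuous_on_subset[OF assms] continuous_on_subset[OF continuous_weight]) auto
  from borel_integrable_compact[OF compact_cball this] show ?thesis by simp
qed

text \<open>The product of f and the weight is homogeneous of degree l + 2 gamma. The factor is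
  positive, so linearity and symmetry can be proved on the ball and transferred.\<close>

lemma sphere_int_ball_int:
  assumes "hpoly l f"
  shows "sphere_int f = (real l + hdim) * ball_int f"
proof -
  have "continuous_on UNIV (\<lambda>x. f x * weight x)"
    by (intro continuous_intros hpoly_continuous[OF assms] continuous_weight)
  moreover have "f (t *\<^sub>R x) * weight (t *\<^sub>R x) = t powr (real l + 2 * gamma) * (f x * weight x)" if "t > 0" for t x
    using that by (simp add: hpoly_scale[OF assms] weight_scale powr_add powr_realpow)
  ultimately show ?thesis
    using integral_cball_homogeneous[of "\<lambda>x. f x * weight x" "real l + 2 * gamma"] gamma_nonneg
    by (simp add: sphere_int_def ball_int_def add.assoc)
qed

lemma ball_int_add:
  assumes "continuous_on UNIV f" "continuous_on UNIV g"
  shows "ball_int (\<lambda>x. f x + g x) = ball_int f + ball_int g"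
  using integrable_ball[OF assms(1)] integrable_ball[OF assms(2)]
  by (simp add: ball_int_def distrib_left distrib_right)

lemma ball_int_cmult: "ball_int (\<lambda>x. c * f x) = c * ball_int f"
proof -
  have "ball_int (\<lambda>x. c * f x) = (\<integral>x. c * (indicator (cball 0 1) x * (f x * weight x)) \<partial>lborel)"
    unfolding ball_int_def by (intro Bochner_Integration.integral_cong) (auto simp: mult_ac)
  then show ?thesis by (simp add: ball_int_def)
qed

lemma sphere_int_zero: "sphere_int (\<lambda>x. 0) = 0"
  by (simp add: sphere_int_def)

lemma sphere_int_cmult: "sphere_int (\<lambda>x. c * f x) = c * sphere_int f"
  by (simp add: sphere_int_def mult.assoc)

lemma sphere_int_add:
  assumes "hpoly l f" "hpoly l g"
  shows "sphere_int (\<lambda>x. f x + g x) = sphere_int f + sphere_int g"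
  using assms hpoly.add[OF assms]
  by (simp add: sphere_int_ball_int[of l] ball_int_add[OF hpoly_continuous hpoly_continuous] distrib_left)

lemma sphere_int_diff:
  assumes "hpoly l f" "hpoly l g"
  shows "sphere_int (\<lambda>x. f x - g x) = sphere_int f - sphere_int g"
  using sphere_int_add[OF assms(1) hpoly_cmult[OF assms(2), of "-1"]] sphere_int_cmult[of "-1" g] by simp

lemma sphere_int_sum:
  assumes "\<And>i. i \<in> A \<Longrightarrow> hpoly l (f i)"
  shows "sphere_int (\<lambda>x. \<Sum>i\<in>A. f i x) = (\<Sum>i\<in>A. sphere_int (f i))"
  using assms
proof (induction A rule: infinite_finite_induct)
  case (insert i A)
  then have "hpoly l (f i)" "hpoly l (\<lambda>x. \<Sum>i\<in>A. f i x)" by (auto intro: hpoly_sum)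
  from sphere_int_add[OF this] insert show ?case by simp
qed (auto simp: sphere_int_zero)

lemma sphere_int_orthogonal:
  assumes "hpoly l f" "orthogonal_transformation r" "\<And>x. weight (r x) = weight x" "hpoly l (\<lambda>x. f (r x))"
  shows "sphere_int (\<lambda>x. f (r x)) = sphere_int f"
proof -
  have "indicator (cball 0 1) (r x) = (indicator (cball 0 1) x :: real)" for x
    using orthogonal_transformation_norm[OF assms(2), of x] by (simp add: indicator_def)
  moreover have "(\<lambda>x. indicator (cball 0 1) x * (f x * weight x)) \<in> borel_measurable borel"
    using integrable_ball[OF hpoly_continuous[OF assms(1)]] by auto
  ultimately have "ball_int (\<lambda>x. f (r x)) = ball_int f"
    using lborel_integral_orthogonal[OF assms(2), of "\<lambda>x. indicator (cball 0 1) x * (f x * weight x)"]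
    by (simp add: ball_int_def assms(3))
  then show ?thesis using assms by (simp add: sphere_int_ball_int[of l])
qed

lemma sphere_int_refl: "hpoly l f \<Longrightarrow> \<alpha> \<in> R \<Longrightarrow> sphere_int (\<lambda>x. f (refl \<alpha> x)) = sphere_int f"
  by (intro sphere_int_orthogonal orthogonal_transformation_refl hpoly_refl weight_refl root_nonzero)

lemma sphere_int_odd:
  assumes "hpoly l f" "odd l"
  shows "sphere_int f = 0"
proof -
  have "orthogonal_transformation (uminus :: real^'n \<Rightarrow> real^'n)"
    by (auto simp: orthogonal_transformation_def intro!: linearI)
  moreover have *: "(\<lambda>x. f (- x)) = (\<lambda>x. - 1 * f x)" using hpoly_minus[OF assms(1)] assms(2) by auto
  moreover have "hpoly l (\<lambda>x. - 1 * f x)" by (rule hpoly_cmult[OF assms(1)])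
  ultimately have "sphere_int (\<lambda>x. - 1 * f x) = sphere_int f"
    using sphere_int_orthogonal[OF assms(1), of uminus] weight_minus by (simp only: *)
  then show ?thesis unfolding sphere_int_cmult by simp
qed

text \<open>If the integral were 0, the open set where the continuous nonnegative weight is nonzero
  would be null in the ball, hence empty. A small multiple of a vector defining the positive system
  lies in it, being on no root hyperplane. This permits division by omega.\<close>

lemma sphere_int_one_neq_0: "sphere_int (\<lambda>x. 1) \<noteq> 0"
proof
  assume "sphere_int (\<lambda>x. 1) = 0"
  then have "ball_int (\<lambda>x. 1) = 0" using sphere_int_ball_int[OF hpoly.const[of 1]] hdim_ge_1 by simp
  moreover have "integrable lborel (\<lambda>x. indicator (cball 0 1) x * weight x)"
    using integrable_ball[of "\<lambda>x. 1"] by simp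
  moreover have "0 \<le> weight x" for x by (simp add: weight_def)
  ultimately have "AE x in lborel. indicator (cball 0 1) x * weight x = 0"
    using integral_nonneg_eq_0_iff_AE[of lborel "\<lambda>x. indicator (cball 0 1) x * weight x"] by (simp add: ball_int_def)
  then have "AE x in lborel. x \<notin> {x \<in> ball 0 1. weight x \<noteq> 0}"
    by eventually_elim (auto simp: indicator_def split: if_splits)
  moreover have op: "open {x \<in> ball 0 1. weight x \<noteq> 0}"
  proof -
    have "open (weight -` (- {0}))" by (intro open_vimage continuous_weight) auto
    then have "open (ball 0 1 \<inter> weight -` (- {0}))" by auto
    also have "ball 0 1 \<inter> weight -` (- {0}) = {x \<in> ball 0 1. weight x \<noteq> 0}" by auto
    finally show ?thesis .
  qed
  ultimately have "{x \<in> ball 0 1. weight x \<noteq> 0} \<in> null_sets lborel"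
    by (subst AE_iff_null_sets) auto
  then have "negligible {x \<in> ball 0 1. weight x \<noteq> 0}"
    by (simp add: negligible_iff_null_sets null_sets_completionI)
  with op have empty: "{x \<in> ball 0 1. weight x \<noteq> 0} = {}" using open_not_negligible by blast
  obtain v where v: "\<forall>\<alpha>\<in>R. \<alpha> \<bullet> v \<noteq> 0"
    using positive_system by (auto simp: positive_system_def)
  let ?x = "(1 / (1 + norm v)) *\<^sub>R v"
  have n: "1 + norm v > 0" using norm_ge_zero[of v] by linarith
  have "?x \<in> ball 0 1" using n by (simp add: divide_simps)
  moreover have "weight ?x \<noteq> 0"
  proof -
    have "\<alpha> \<bullet> ?x \<noteq> 0" if "\<alpha> \<in> Rp" for \<alpha>
      using v that Rp_subset n by auto
    then show ?thesis using finite_Rp by (auto simp: weight_eq)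
  qed
  ultimately show False using empty by blast
qed

lemma sphere_int_norm_sq:
  assumes "hpoly l f"
  shows "sphere_int (\<lambda>x. (x \<bullet> x) * f x) = sphere_int f"
  unfolding sphere_int_def
proof (rule Bochner_Integration.integral_cong[OF HOL.refl])
  fix y :: "real^'n" assume "y \<in> space sphere_measure"
  then have "norm y = 1" by (simp add: sphere_measure_eq_distr space_restrict_space)
  then have "y \<bullet> y = 1" by (simp add: dot_square_norm)
  then show "(y \<bullet> y) * f y * weight y = f y * weight y" by simp
qed

text \<open>Expanding the cut-off \<open>(1 - |x|\<^sup>2)\<^sup>2\<close> turns the integration by parts on the ball into one on the
  sphere: every ball integral that occurs is a known multiple of one of two spherical integrals.\<close>

lemma sphere_int_dunkl:
  assumes f: "hpoly l f"
  shows "sphere_int (\<D> \<xi> f) = (real l - 1 + hdim) * sphere_int (\<lambda>x. (\<xi> \<bullet> x) * f x)"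
proof (cases l)
  \<comment> \<open>There is no degree \<open>l - 1\<close> to work with. Both sides vanish: f is
    constant, and a multiple of a linear form is odd.\<close>
  case 0
  then have "sphere_int (\<lambda>x. (\<xi> \<bullet> x) * f x) = 0"
    using sphere_int_odd[OF hpoly_inner_mult[OF f]] by simp
  with 0 f show ?thesis by (simp add: dunkl_hpoly_0 sphere_int_zero)
next
  case (Suc k)
  define g where "g = \<D> \<xi> f"
  define u where "u x = (\<xi> \<bullet> x) * f x" for x
  define M where "M = real k + hdim"
  have M: "M > 0" using hdim_ge_1 by (simp add: M_def)
  have g: "hpoly k g" using f Suc by (simp add: g_def hpoly_dunkl)
  have u: "hpoly (k + 2) u" using hpoly_inner_mult[OF f, of \<xi>] Suc by (simp add: u_def[abs_def])
  let ?N = "\<lambda>h x. (x \<bullet> x) * h x"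
  have hN: "hpoly (k + 2) (?N g)" "hpoly (k + 4) (?N (?N g))" "hpoly (k + 4) (?N u)"
    using hpoly_norm_sq[OF g] hpoly_norm_sq[OF hpoly_norm_sq[OF g]] hpoly_norm_sq[OF u] by (simp_all add: numeral_eq_Suc)
  have r: "real (k + 2) + hdim = M + 2" "real (k + 4) + hdim = M + 4" by (simp_all add: M_def)
  \<comment> \<open>A factor \<open>x \<bullet> x\<close> raises the degree, and so changes the
    ratio to the ball integral, but leaves the sphere integral alone.\<close>
  have b: "sphere_int g = M * ball_int g" "sphere_int g = (M + 2) * ball_int (?N g)" "sphere_int g = (M + 4) * ball_int (?N (?N g))"
    "sphere_int u = (M + 2) * ball_int u" "sphere_int u = (M + 4) * ball_int (?N u)"
    using sphere_int_ball_int[OF g] sphere_int_ball_int[OF hN(1)] sphere_int_ball_int[OF hN(2)] sphere_int_ball_int[OF u] sphere_int_ball_int[OF hN(3)]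
    unfolding sphere_int_norm_sq[OF g] sphere_int_norm_sq[OF hN(1)] sphere_int_norm_sq[OF u] r by (simp_all add: M_def)
  have q: "sphere_int g / M = ball_int g" "sphere_int g / (M + 2) = ball_int (?N g)" "sphere_int g / (M + 4) = ball_int (?N (?N g))"
    "sphere_int u / (M + 2) = ball_int u" "sphere_int u / (M + 4) = ball_int (?N u)"
    using M by (simp add: b(1), simp add: b(2), simp add: b(3), simp add: b(4), simp add: b(5))
  note cont = hpoly_continuous[OF g] hpoly_continuous[OF u]
  have "0 = (\<integral>x. (g x * (cutoff x)\<^sup>2 - 4 * (\<xi> \<bullet> x) * f x * cutoff x) * weight x \<partial>lborel)"
    using integral_dunkl_by_parts[OF f, of \<xi>] by (simp add: g_def)
  also have "\<dots> = ball_int (\<lambda>x. (g x + (- 2) * ?N g x) + (?N (?N g) x + ((- 4) * u x + 4 * ?N u x)))"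
    unfolding ball_int_def
  proof (intro Bochner_Integration.integral_cong HOL.refl)
    fix x :: "real^'n"
    show "(g x * (cutoff x)\<^sup>2 - 4 * (\<xi> \<bullet> x) * f x * cutoff x) * weight x
      = indicator (cball 0 1) x * (((g x + (- 2) * ?N g x) + (?N (?N g) x + ((- 4) * u x + 4 * ?N u x))) * weight x)"
    proof (cases "norm x \<le> 1")
      case True
      then have "x \<bullet> x \<le> 1" by (simp add: dot_square_norm power_le_one)
      with True show ?thesis by (simp add: cutoff_def u_def power2_eq_square algebra_simps)
    qed (simp add: cutoff_eq_0)
  qed
  also have "\<dots> = (ball_int g - 2 * ball_int (?N g)) + (ball_int (?N (?N g)) + (- 4 * ball_int u + 4 * ball_int (?N u)))"
  proof -
    have 1: "ball_int (\<lambda>x. g x + (- 2) * ?N g x) = ball_int g - 2 * ball_int (?N g)"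
      by (subst ball_int_add) (auto intro!: continuous_intros cont simp: ball_int_cmult[of "-2" "?N g", simplified])
    have 2: "ball_int (\<lambda>x. (- 4) * u x + 4 * ?N u x) = - 4 * ball_int u + 4 * ball_int (?N u)"
      unfolding ball_int_cmult[symmetric] by (rule ball_int_add) (intro continuous_intros cont)+
    have 3: "ball_int (\<lambda>x. ?N (?N g) x + ((- 4) * u x + 4 * ?N u x)) = ball_int (?N (?N g)) + ball_int (\<lambda>x. (- 4) * u x + 4 * ?N u x)"
      by (rule ball_int_add) (intro continuous_intros cont)+
    show ?thesis unfolding 1[symmetric] 2[symmetric] 3[symmetric]
      by (rule ball_int_add) (intro continuous_intros cont)+
  qed
  finally have "0 = (sphere_int g / M - 2 * (sphere_int g / (M + 2))) + (sphere_int g / (M + 4) + (- 4 * (sphere_int u / (M + 2)) + 4 * (sphere_int u / (M + 4))))"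
    unfolding q .
  \<comment> \<open>The second difference of 1/M with step 2 is 8 / (M (M+2) (M+4)), and 4 times the
    first difference of 1/(M+2) is -M times the same number. This common nonzero factor cancels and
    leaves the multiplier M.\<close>
  moreover have "sphere_int g / M - 2 * (sphere_int g / (M + 2)) + sphere_int g / (M + 4) = sphere_int g * (8 / (M * (M + 2) * (M + 4)))"
    using M by (simp add: divide_simps) (simp add: algebra_simps)
  moreover have "- 4 * (sphere_int u / (M + 2)) + 4 * (sphere_int u / (M + 4)) = - (M * sphere_int u) * (8 / (M * (M + 2) * (M + 4)))"
    using M by (simp add: divide_simps) (simp add: algebra_simps)
  ultimately have "(sphere_int g - M * sphere_int u) * (8 / (M * (M + 2) * (M + 4))) = 0"
    unfolding left_diff_distrib minus_mult_left[symmetric] by linarith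
  then have "sphere_int g = M * sphere_int u" using M by simp
  then show ?thesis using Suc by (simp add: g_def u_def[abs_def] M_def)
qed

section \<open>Product rule, Green's formula and orthogonality\<close>

lemma hpoly_mult_dunkl_left: "hpoly a f \<Longrightarrow> hpoly b g \<Longrightarrow> hpoly (a + b - 1) (\<lambda>x. \<D> \<xi> f x * g x)"
  using hpoly_mult[OF hpoly_dunkl] by (cases a) (auto simp: dunkl_hpoly_0 hpoly_zero)

lemma hpoly_mult_dunkl_right: "hpoly a f \<Longrightarrow> hpoly b g \<Longrightarrow> hpoly (a + b - 1) (\<lambda>x. f x * \<D> \<xi> g x)"
  using hpoly_mult_dunkl_left[of b g a f] by (simp add: mult.commute add.commute)

text \<open>The Leibniz rule fails only by the terms \<open>\<langle>\<alpha>,x\<rangle> Q\<^sub>\<alpha>f Q\<^sub>\<alpha>g\<close>, with \<open>Q\<^sub>\<alpha>\<close> the difference quotient; these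
  are odd under the reflection in \<open>\<alpha>\<close> and integrate to zero.\<close>

lemma sphere_int_dunkl_mult:
  assumes f: "hpoly a f" and g: "hpoly b g"
  shows "sphere_int (\<lambda>x. \<D> \<xi> f x * g x) + sphere_int (\<lambda>x. f x * \<D> \<xi> g x)
    = (real a + real b - 1 + hdim) * sphere_int (\<lambda>x. (\<xi> \<bullet> x) * (f x * g x))"
proof -
  define E where "E \<alpha> x = (\<alpha> \<bullet> x) * (diffquot \<alpha> f x * diffquot \<alpha> g x)" for \<alpha> x
  note fg = hpoly_mult[OF f g]
  have E: "hpoly (a + b - 1) (E \<alpha>) \<and> sphere_int (E \<alpha>) = 0" if a: "\<alpha> \<in> Rp" for \<alpha>
  proof -
    have a0: "\<alpha> \<noteq> 0" and aR: "\<alpha> \<in> R" using a Rp_nonzero Rp_subset by auto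
    have h: "hpoly (a + b - 1) (E \<alpha>)"
    proof (cases "a = 0 \<or> b = 0")
      case True
      then have "E \<alpha> = (\<lambda>x. 0)"
        using hpoly_diffquot[OF a0 f] hpoly_diffquot[OF a0 g] by (auto simp: E_def fun_eq_iff)
      then show ?thesis by (simp add: hpoly_zero)
    next
      case False
      then have "hpoly (Suc (a - 1 + (b - 1))) (E \<alpha>)"
        using hpoly_diffquot[OF a0 f] hpoly_diffquot[OF a0 g] unfolding E_def
        by (intro hpoly_inner_mult hpoly_mult) auto
      moreover have "Suc (a - 1 + (b - 1)) = a + b - 1" using False by auto
      ultimately show ?thesis by metis
    qed
    have "\<alpha> \<bullet> refl \<alpha> x = - (\<alpha> \<bullet> x)" for x
      using inner_refl_swap[OF a0, of \<alpha> x] by (simp add: refl_self a0)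
    then have "(\<lambda>x. E \<alpha> (refl \<alpha> x)) = (\<lambda>x. - 1 * E \<alpha> x)"
      by (simp add: E_def diffquot_refl[OF a0])
    with sphere_int_refl[OF h aR] sphere_int_cmult[of "- 1" "E \<alpha>"] have "sphere_int (E \<alpha>) = 0" by simp
    with h show ?thesis by simp
  qed
  have "\<D> \<xi> (\<lambda>x. f x * g x) x = (\<D> \<xi> f x * g x + f x * \<D> \<xi> g x) - (\<Sum>\<alpha>\<in>Rp. \<kappa> \<alpha> * (\<alpha> \<bullet> \<xi>) * E \<alpha> x)" for x
    unfolding dunkl_diffquot ddir_mult[OF f g] diffquot_mult[OF f g] E_def
    by (simp add: algebra_simps sum.distrib sum_subtractf sum_distrib_left)
  then have "sphere_int (\<D> \<xi> (\<lambda>x. f x * g x)) = sphere_int (\<lambda>x. (\<D> \<xi> f x * g x + f x * \<D> \<xi> g x) - (\<Sum>\<alpha>\<in>Rp. \<kappa> \<alpha> * (\<alpha> \<bullet> \<xi>) * E \<alpha> x))"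
    by presburger
  also have "\<dots> = sphere_int (\<lambda>x. \<D> \<xi> f x * g x + f x * \<D> \<xi> g x) - sphere_int (\<lambda>x. \<Sum>\<alpha>\<in>Rp. \<kappa> \<alpha> * (\<alpha> \<bullet> \<xi>) * E \<alpha> x)"
    using E by (intro sphere_int_diff[of "a + b - 1"] hpoly.add hpoly_mult_dunkl_left hpoly_mult_dunkl_right f g hpoly_sum hpoly_cmult) auto
  also have "sphere_int (\<lambda>x. \<Sum>\<alpha>\<in>Rp. \<kappa> \<alpha> * (\<alpha> \<bullet> \<xi>) * E \<alpha> x) = (\<Sum>\<alpha>\<in>Rp. sphere_int (\<lambda>x. \<kappa> \<alpha> * (\<alpha> \<bullet> \<xi>) * E \<alpha> x))"
    using E by (intro sphere_int_sum[of _ "a + b - 1"] hpoly_cmult) auto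
  also have "\<dots> = 0" using E by (intro sum.neutral ballI) (simp add: sphere_int_cmult)
  also have "sphere_int (\<lambda>x. \<D> \<xi> f x * g x + f x * \<D> \<xi> g x) = sphere_int (\<lambda>x. \<D> \<xi> f x * g x) + sphere_int (\<lambda>x. f x * \<D> \<xi> g x)"
    by (intro sphere_int_add[of "a + b - 1"] hpoly_mult_dunkl_left hpoly_mult_dunkl_right f g)
  finally show ?thesis using sphere_int_dunkl[OF fg, of \<xi>] by simp
qed

text \<open>In the direction x itself the factor <\<alpha>,x> cancels the denominator of each
  divided difference, and homogeneity evaluates the derivative.\<close>

lemma euler_dunkl:
  assumes "hpoly a f"
  shows "(\<Sum>j\<in>UNIV. x $ j * \<D> (axis j 1) f x) = real a * f x + (\<Sum>\<alpha>\<in>Rp. \<kappa> \<alpha> * (f x - f (refl \<alpha> x)))"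
proof -
  have "f (x + t *\<^sub>R x) = (1 + t) ^ a * f x" for t
    using hpoly_scale[OF assms, of "1 + t" x] by (simp add: scaleR_add_left)
  moreover have "((\<lambda>t. (1 + t) ^ a * f x) has_real_derivative real a * f x) (at 0)"
    by (auto intro!: derivative_eq_intros)
  ultimately have "ddir x f x = real a * f x"
    unfolding ddir_def by (simp add: DERIV_imp_deriv)
  then have "\<D> x f x = real a * f x + (\<Sum>\<alpha>\<in>Rp. \<kappa> \<alpha> * (f x - f (refl \<alpha> x)))"
    by (simp add: dunkl_diffquot mult.assoc inner_mult_diffquot)
  then show ?thesis by (simp only: dunkl_sum_direction[OF assms])
qed

text \<open>The reflection sums in Euler's identity for f and for g have equal integrals, since a
  reflection can be moved from one factor to the other. Only the difference of the degrees
  remains.\<close>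

lemma sphere_int_euler_diff:
  assumes f: "hpoly a f" and g: "hpoly b g"
  shows "(\<Sum>j\<in>UNIV. sphere_int (\<lambda>x. x $ j * (\<D> (axis j 1) f x * g x))) - (\<Sum>j\<in>UNIV. sphere_int (\<lambda>x. x $ j * (f x * \<D> (axis j 1) g x)))
    = (real a - real b) * sphere_int (\<lambda>x. f x * g x)"
proof -
  have *: "(\<Sum>j\<in>UNIV. sphere_int (\<lambda>x. x $ j * (\<D> (axis j 1) f x * g x)))
    = real a * sphere_int (\<lambda>x. f x * g x) + (\<Sum>\<alpha>\<in>Rp. \<kappa> \<alpha> * (sphere_int (\<lambda>x. f x * g x) - sphere_int (\<lambda>x. f (refl \<alpha> x) * g x)))"
    if f: "hpoly a f" and g: "hpoly b g" for a b f g
  proof -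
    note fg = hpoly_mult[OF f g] hpoly_mult[OF hpoly_refl[OF f] g]
    have "(\<Sum>j\<in>UNIV. sphere_int (\<lambda>x. x $ j * (\<D> (axis j 1) f x * g x))) = sphere_int (\<lambda>x. \<Sum>j\<in>UNIV. x $ j * \<D> (axis j 1) f x * g x)"
      using hpoly_mult[OF hpoly_mult_dunkl[OF f] g] by (subst sphere_int_sum[of _ "a + b"]) (auto simp: mult.assoc)
    also have "\<dots> = sphere_int (\<lambda>x. real a * (f x * g x) + (\<Sum>\<alpha>\<in>Rp. \<kappa> \<alpha> * (f x * g x - f (refl \<alpha> x) * g x)))"
      unfolding sum_distrib_right[symmetric] euler_dunkl[OF f]
      by (simp add: distrib_right sum_distrib_right left_diff_distrib mult.assoc)
    also have "\<dots> = real a * sphere_int (\<lambda>x. f x * g x) + (\<Sum>\<alpha>\<in>Rp. \<kappa> \<alpha> * (sphere_int (\<lambda>x. f x * g x) - sphere_int (\<lambda>x. f (refl \<alpha> x) * g x)))"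
      by (subst sphere_int_add[of "a + b"] sphere_int_sum[of _ "a + b"] sphere_int_cmult sphere_int_diff[of "a + b"];
          (intro hpoly_cmult hpoly_sum hpoly_diff fg)?)+ simp
    finally show ?thesis .
  qed
  have "sphere_int (\<lambda>x. g (refl \<alpha> x) * f x) = sphere_int (\<lambda>x. f (refl \<alpha> x) * g x)" if "\<alpha> \<in> Rp" for \<alpha>
    using sphere_int_refl[OF hpoly_mult[OF hpoly_refl[OF g, of \<alpha>] f], of \<alpha>] that Rp_subset
    by (auto simp: refl_refl Rp_nonzero mult.commute)
  then show ?thesis
    using *[OF f g] *[OF g f] by (simp add: mult.commute[of "g _"] mult.commute[of _ "f _"] left_diff_distrib cong: sum.cong)
qed

text \<open>Integrating by parts once from f and once from g produces the same mixed sum of D_j f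
  D_j g. Subtraction removes it together with the harmonic term, and the Euler difference supplies
  the factor a - b.\<close>

lemma sphere_int_green:
  assumes f: "hpoly a f" and g: "hpoly b g" and harm: "Lap g = (\<lambda>x. 0)"
  shows "sphere_int (\<lambda>x. Lap f x * g x) = (real a + real b - 2 + hdim) * (real a - real b) * sphere_int (\<lambda>x. f x * g x)"
proof -
  let ?e = "\<lambda>j. axis j 1 :: real^'n"
  let ?D = "\<lambda>j. \<D> (?e j)"
  let ?c = "real a + real b - 2 + hdim"
  \<comment> \<open>The constant is kept abstract so that the call with f and g exchanged gives it
    in the same form.\<close>
  have 1: "sphere_int (\<lambda>x. ?D j (?D j f) x * g x) + sphere_int (\<lambda>x. ?D j f x * ?D j g x) = c * sphere_int (\<lambda>x. x $ j * (?D j f x * g x))"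
    if f: "hpoly a f" and g: "hpoly b g" and c: "c = real a + real b - 2 + hdim" for a b f g j c
  proof (cases a)
    case 0
    with f show ?thesis by (simp add: dunkl_hpoly_0 dunkl_const sphere_int_zero)
  next
    case (Suc k)
    with sphere_int_dunkl_mult[OF hpoly_dunkl g, of k f "?e j" "?e j"] f show ?thesis by (simp add: inner_axis' c)
  qed
  have L: "(\<Sum>j\<in>UNIV. sphere_int (\<lambda>x. ?D j (?D j f) x * g x)) = sphere_int (\<lambda>x. Lap f x * g x)"
    if f: "hpoly a f" and g: "hpoly b g" for a b f g
    unfolding laplacian_eq sum_distrib_right
    by (rule sphere_int_sum[symmetric]) (rule hpoly_mult[OF hpoly_dunkl_any[OF hpoly_dunkl_any[OF f]] g])
  have "sphere_int (\<lambda>x. Lap f x * g x) + (\<Sum>j\<in>UNIV. sphere_int (\<lambda>x. ?D j f x * ?D j g x))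
    = ?c * (\<Sum>j\<in>UNIV. sphere_int (\<lambda>x. x $ j * (?D j f x * g x)))"
    unfolding L[OF f g, symmetric] sum.distrib[symmetric] 1[OF f g HOL.refl] sum_distrib_left ..
  moreover have "sphere_int (\<lambda>x. Lap g x * f x) + (\<Sum>j\<in>UNIV. sphere_int (\<lambda>x. ?D j g x * ?D j f x))
    = ?c * (\<Sum>j\<in>UNIV. sphere_int (\<lambda>x. x $ j * (?D j g x * f x)))"
    unfolding L[OF g f, symmetric] sum.distrib[symmetric] sum_distrib_left
    by (intro sum.cong HOL.refl 1[OF g f]) (simp add: sum_distrib_left)
  ultimately have "sphere_int (\<lambda>x. Lap f x * g x) = ?c * ((\<Sum>j\<in>UNIV. sphere_int (\<lambda>x. x $ j * (?D j f x * g x)))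
    - (\<Sum>j\<in>UNIV. sphere_int (\<lambda>x. x $ j * (f x * ?D j g x))))"
    by (simp add: harm sphere_int_zero mult.commute[of _ "f _"] mult.commute[of "?D _ g _"] right_diff_distrib)
  then show ?thesis unfolding sphere_int_euler_diff[OF f g] by (simp only: mult.assoc)
qed

lemma sphere_int_laplacian:
  assumes "hpoly a f"
  shows "sphere_int (Lap f) = real a * (real a - 2 + hdim) * sphere_int f"
  using sphere_int_green[OF assms hpoly.const[of 1] laplacian_const] by simp

lemma laplacian_low: "hpoly l f \<Longrightarrow> l < 2 \<Longrightarrow> Lap f = (\<lambda>x. 0)"
  using dunkl_hpoly_0[of "\<D> _ f"] hpoly_dunkl_any[of l f]
  by (auto simp: less_2_cases_iff laplacian_eq)

text \<open>Green's formula makes the pairing of f with q proportional to that of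
  \<open>Lap f\<close> with q, which vanishes by induction on the degree.\<close>

lemma sphere_int_harmonic_orthogonal:
  assumes q: "hpoly m q" "Lap q = (\<lambda>x. 0)"
  shows "hpoly a f \<Longrightarrow> a < m \<Longrightarrow> sphere_int (\<lambda>x. f x * q x) = 0"
proof (induction a arbitrary: f rule: less_induct)
  case (less a)
  show ?case
  proof (cases "odd (a + m)")
    case True
    then show ?thesis using sphere_int_odd[OF hpoly_mult[OF less.prems(1) q(1)]] by simp
  next
    case False
    have "sphere_int (\<lambda>x. Lap f x * q x) = 0"
    proof (cases "a < 2")
      case True
      then show ?thesis using laplacian_low[OF less.prems(1)] by (simp add: sphere_int_zero)
    next
      case False
      then show ?thesis using less.IH[OF _ hpoly_laplacian[OF less.prems(1)]] less.prems(2) by simp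
    qed
    then have "(real a + real m - 2 + hdim) * (real a - real m) * sphere_int (\<lambda>x. f x * q x) = 0"
      using sphere_int_green[OF less.prems(1) q] by simp
    \<comment> \<open>The value a + m = 1 went with the odd case; there Green's factor
      \<open>hdim - 1\<close> could be 0.\<close>
    moreover have "a + m \<ge> 2" using False less.prems(2) by (cases "a + m = 1") auto
    then have "real a + real m \<ge> 2" by linarith
    then have "real a + real m - 2 + hdim \<noteq> 0" using hdim_ge_1 by linarith
    ultimately show ?thesis using less.prems(2) by simp
  qed
qed

lemma hpoly_laplacian_power: "hpoly (m + 2 * n) f \<Longrightarrow> hpoly m ((Lap ^^ n) f)"
proof (induction n arbitrary: f)
  case (Suc n)
  have "hpoly (m + 2 * n) (Lap f)" using hpoly_laplacian[OF Suc.prems] by simp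
  from Suc.IH[OF this] show ?case by (simp add: funpow_Suc_right del: funpow.simps)
qed simp

text \<open>In degree m + 2 (n + 1) Green's factor equals 4 (n + 1) (lambda + 1 + m + n); its parts
  build up the power, the factorial and the Pochhammer symbol.\<close>

lemma sphere_int_laplacian_power:
  assumes q: "hpoly m q" "Lap q = (\<lambda>x. 0)"
  shows "hpoly (m + 2 * n) f \<Longrightarrow> sphere_int (\<lambda>x. (Lap ^^ n) f x * q x)
    = 4 ^ n * fact n * pochhammer (lambda_kappa Rp \<kappa> + 1 + real m) n * sphere_int (\<lambda>x. f x * q x)"
proof (induction n arbitrary: f)
  case (Suc n)
  have "hpoly (m + 2 * n) (Lap f)" using hpoly_laplacian[OF Suc.prems] by simp
  from Suc.IH[OF this] show ?case
    unfolding sphere_int_green[OF Suc.prems q] lambda_kappa_hdim[symmetric]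
    by (simp add: funpow_Suc_right pochhammer_Suc algebra_simps del: funpow.simps)
qed simp

section \<open>Iterated commutators with the Laplacian\<close>

text \<open>The k-th iterate of ad(Lap), applied to the operator of multiplication by q and
  evaluated at f.\<close>

fun lap_comm :: "nat \<Rightarrow> (real^'n \<Rightarrow> real) \<Rightarrow> (real^'n \<Rightarrow> real) \<Rightarrow> real^'n \<Rightarrow> real" where
  "lap_comm 0 q f = (\<lambda>x. q x * f x)"
| "lap_comm (Suc k) q f = (\<lambda>x. Lap (lap_comm k q f) x - lap_comm k q (Lap f) x)"

lemma lap_comm_zero: "lap_comm k q (\<lambda>x. 0) = (\<lambda>x. 0)"
  by (induction k) (simp_all add: laplacian_const)

text \<open>The second part is not an instance of the first: for b < 2 the truncated degree b - 2
  would be too large, and there \<open>Lap f\<close> is 0 instead.\<close>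

lemma hpoly_lap_comm_both:
  assumes "hpoly a q"
  shows "hpoly b f \<Longrightarrow> hpoly (a + b - 2 * k) (lap_comm k q f) \<and> hpoly (a + b - 2 * Suc k) (lap_comm k q (Lap f))"
proof (induction k arbitrary: b f)
  case 0
  then show ?case
    using hpoly_mult[OF assms 0] hpoly_mult[OF assms hpoly_laplacian[OF 0]] laplacian_low[OF 0]
    by (cases "b < 2") (auto simp: hpoly_zero Nat.add_diff_assoc)
next
  case (Suc k)
  have *: "hpoly (a + b - 2 * Suc k) (lap_comm (Suc k) q f)" if "hpoly b f" for b f
    using Suc.IH[OF that] hpoly_laplacian[of "a + b - 2 * k" "lap_comm k q f"]
    by (auto intro!: hpoly_diff simp: diff_diff_left)
  have "hpoly (a + b - 2 * Suc (Suc k)) (lap_comm (Suc k) q (Lap f))"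
  proof (cases "b < 2")
    case True
    then show ?thesis using laplacian_low[OF Suc.prems] by (simp add: lap_comm_zero hpoly_zero del: lap_comm.simps)
  next
    case False
    have "a + (b - 2) - 2 * Suc k = a + b - 2 * Suc (Suc k)" using False by simp
    then show ?thesis using *[OF hpoly_laplacian[OF Suc.prems]] by metis
  qed
  with *[OF Suc.prems] show ?case by blast
qed

lemmas hpoly_lap_comm = hpoly_lap_comm_both[THEN conjunct1] and hpoly_lap_comm_lap = hpoly_lap_comm_both[THEN conjunct2]

lemma lap_comm_add:
  assumes "hpoly a p" "hpoly a q"
  shows "hpoly b f \<Longrightarrow> lap_comm k (\<lambda>x. p x + q x) f = (\<lambda>x. lap_comm k p f x + lap_comm k q f x)"
proof (induction k arbitrary: b f)
  case (Suc k)
  show ?case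
    using Suc.IH[OF Suc.prems] Suc.IH[OF hpoly_laplacian[OF Suc.prems]]
    by (simp add: laplacian_add[OF hpoly_lap_comm[OF assms(1) Suc.prems] hpoly_lap_comm[OF assms(2) Suc.prems]] algebra_simps)
qed (simp add: distrib_right)

lemma lap_comm_cmult:
  assumes "hpoly a q"
  shows "hpoly b f \<Longrightarrow> lap_comm k (\<lambda>x. c * q x) f = (\<lambda>x. c * lap_comm k q f x)"
proof (induction k arbitrary: b f)
  case (Suc k)
  show ?case
    using Suc.IH[OF Suc.prems] Suc.IH[OF hpoly_laplacian[OF Suc.prems]]
    by (simp add: laplacian_cmult[OF hpoly_lap_comm[OF assms(1) Suc.prems]] algebra_simps)
qed (simp add: mult.assoc)

lemma lap_comm_sum:
  assumes "\<And>i. i \<in> A \<Longrightarrow> hpoly a (q i)" "hpoly b f"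
  shows "lap_comm k (\<lambda>x. \<Sum>i\<in>A. q i x) f = (\<lambda>x. \<Sum>i\<in>A. lap_comm k (q i) f x)"
  using assms(1)
proof (induction A rule: infinite_finite_induct)
  case (insert i A)
  then have "hpoly a (q i)" "hpoly a (\<lambda>x. \<Sum>i\<in>A. q i x)" by (auto intro: hpoly_sum)
  from lap_comm_add[OF this assms(2)] insert show ?case by simp
qed (use lap_comm_cmult[OF hpoly.const assms(2), of k 0 0] in simp_all)

text \<open>Leibniz rule for ad(Lap): its value at x_j is 2 D_j, which commutes with
  \<open>Lap\<close>, so at most one of the k commutators can fall on x_j. For k = 0 the factor
  \<open>real k\<close> disposes of the truncated index k - 1.\<close>

lemma lap_comm_coord_mult:
  assumes q: "hpoly a q"
  shows "hpoly b f \<Longrightarrow> lap_comm k (\<lambda>x. x $ j * q x) f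
    = (\<lambda>x. x $ j * lap_comm k q f x + 2 * real k * \<D> (axis j 1) (lap_comm (k - 1) q f) x)"
proof (induction k arbitrary: b f)
  case (Suc k)
  let ?D = "\<D> (axis j 1)"
  note h = hpoly_lap_comm[OF q Suc.prems]
  have "Lap (lap_comm k (\<lambda>x. x $ j * q x) f) x
    = x $ j * Lap (lap_comm k q f) x + 2 * ?D (lap_comm k q f) x + 2 * real k * ?D (Lap (lap_comm (k - 1) q f)) x" for x
    unfolding Suc.IH[OF Suc.prems]
    by (subst laplacian_add[OF hpoly.mult[OF h] hpoly_cmult[OF hpoly_dunkl_any[OF h]]])
      (simp add: laplacian_coord_mult[OF h] laplacian_cmult[OF hpoly_dunkl_any[OF h]] laplacian_dunkl_commute[OF h])
  moreover have "2 * real k * ?D (Lap (lap_comm (k - 1) q f)) x - 2 * real k * ?D (lap_comm (k - 1) q (Lap f)) x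
    = 2 * real k * ?D (lap_comm k q f) x" for x
  proof (cases k)
    case (Suc i)
    have "?D (lap_comm k q f) = (\<lambda>x. ?D (Lap (lap_comm i q f)) x - ?D (lap_comm i q (Lap f)) x)"
      unfolding Suc lap_comm.simps
      by (rule dunkl_diff[OF hpoly_laplacian[OF h] hpoly_lap_comm_lap[OF q Suc.prems]])
    then show ?thesis using Suc by (simp add: right_diff_distrib)
  qed simp
  ultimately show ?case
    unfolding lap_comm.simps(2)[of k "\<lambda>x. x $ j * q x"] Suc.IH[OF hpoly_laplacian[OF Suc.prems]]
    by (simp add: fun_eq_iff algebra_simps)
qed (simp add: mult.assoc)

text \<open>Each commutator uses up at most one coordinate factor, and a single further one kills a
  constant. In the coordinate rule both summands still have more commutators than factors.\<close>

lemma lap_comm_eq_0: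
  assumes f: "hpoly b f"
  shows "hpoly a q \<Longrightarrow> a < k \<Longrightarrow> lap_comm k q f = (\<lambda>x. 0)"
proof (induction arbitrary: k rule: hpoly.induct)
  case (const c)
  have "lap_comm (Suc k) (\<lambda>x. c) f = (\<lambda>x. 0)" if "hpoly b f" for k b f
    using that
  proof (induction k arbitrary: b f)
    case 0
    then show ?case by (simp add: laplacian_cmult)
  next
    case (Suc k)
    show ?case
      unfolding lap_comm.simps(2)[of "Suc k"] Suc.IH[OF Suc.prems] Suc.IH[OF hpoly_laplacian[OF Suc.prems]]
      by (simp add: laplacian_const)
  qed
  with f const show ?case by (cases k) auto
next
  case (mult l q j)
  then show ?case
    unfolding lap_comm_coord_mult[OF mult.hyps f] by (simp add: dunkl_const)
next
  case (add l p q)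
  then show ?case unfolding lap_comm_add[OF add.hyps f] by simp
qed

section \<open>Commutators with monomials\<close>

lemma hpoly_dunkl_j: "hpoly l f \<Longrightarrow> hpoly (l - 1) (dunkl_j Rp \<kappa> j f)"
  unfolding dunkl_j_def by (rule hpoly_dunkl_any)

lemma hpoly_dunkl_j_power: "hpoly l f \<Longrightarrow> hpoly (l - k) ((dunkl_j Rp \<kappa> j ^^ k) f)"
  by (induction k) (auto dest: hpoly_dunkl_j)

lemma dunkl_j_power_cmult:
  "hpoly l f \<Longrightarrow> (dunkl_j Rp \<kappa> j ^^ k) (\<lambda>x. c * f x) = (\<lambda>x. c * (dunkl_j Rp \<kappa> j ^^ k) f x)"
  by (induction k) (auto simp: dunkl_j_def dunkl_cmult[OF hpoly_dunkl_j_power[unfolded dunkl_j_def]])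

text \<open>With exactly as many commutators as coordinate factors, the undifferentiated term of the
  coordinate rule is 0. Each new factor x_j thus contributes 2 D_j times the current degree, and the
  degrees multiply to a quotient of factorials.\<close>

lemma lap_comm_coord_power:
  assumes q: "hpoly a q" and f: "hpoly b f"
  shows "lap_comm (k + a) (\<lambda>x. (x $ j) ^ k * q x) f
    = (\<lambda>x. 2 ^ k * (fact (k + a) / fact a) * (dunkl_j Rp \<kappa> j ^^ k) (lap_comm a q f) x)"
proof (induction k)
  case (Suc k)
  note h = hpoly_coord_power[OF q, of k j]
  have "lap_comm (Suc k + a) (\<lambda>x. (x $ j) ^ Suc k * q x) f = (\<lambda>x. 2 * real (Suc k + a) * dunkl_j Rp \<kappa> j (lap_comm (k + a) (\<lambda>x. (x $ j) ^ k * q x) f) x)"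
    using lap_comm_coord_mult[OF h f, of "Suc k + a" j] lap_comm_eq_0[OF f h, of "Suc k + a"]
    by (simp add: mult.assoc dunkl_j_def del: lap_comm.simps of_nat_Suc of_nat_add)
  also have "\<dots> = (\<lambda>x. 2 * real (Suc k + a) * (2 ^ k * (fact (k + a) / fact a) * (dunkl_j Rp \<kappa> j ^^ Suc k) (lap_comm a q f) x))"
    unfolding Suc.IH
    using dunkl_j_power_cmult[OF hpoly_dunkl_j_power[OF hpoly_lap_comm[OF q f, of a], of k j], where j = j and k = 1 and c = "2 ^ k * (fact (k + a) / fact a)"]
    by simp
  finally show ?case by (simp add: algebra_simps)
qed simp

text \<open>The list fixes the same order of composition as \<open>dunkl_mono\<close>. The degree
  clause is carried along because scalars pass through the next power of D_i only on homogeneous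
  polynomials.\<close>

lemma lap_comm_monomial:
  fixes a :: "'n \<Rightarrow> nat"
  assumes f: "hpoly b f"
  shows "(\<exists>l. hpoly l (foldr (\<lambda>i g. (dunkl_j Rp \<kappa> i ^^ a i) g) xs f)) \<and>
    lap_comm (\<Sum>i\<leftarrow>xs. a i) (\<lambda>x. \<Prod>i\<leftarrow>xs. (x $ i) ^ a i) f
    = (\<lambda>x. 2 ^ (\<Sum>i\<leftarrow>xs. a i) * fact (\<Sum>i\<leftarrow>xs. a i) * foldr (\<lambda>i g. (dunkl_j Rp \<kappa> i ^^ a i) g) xs f x)"
proof (induction xs)
  case Nil
  then show ?case using f by auto
next
  case (Cons i xs)
  define m where "m = (\<Sum>i\<leftarrow>xs. a i)"
  define q where "q = (\<lambda>x::real^'n. \<Prod>i\<leftarrow>xs. (x $ i) ^ a i)"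
  define g where "g = foldr (\<lambda>i g. (dunkl_j Rp \<kappa> i ^^ a i) g) xs f"
  have q: "hpoly m q" unfolding m_def q_def by (rule hpoly_monomial_list)
  from Cons obtain l where g: "hpoly l g" and e: "lap_comm m q f = (\<lambda>x. 2 ^ m * fact m * g x)"
    by (auto simp: m_def q_def g_def)
  have "lap_comm (a i + m) (\<lambda>x. (x $ i) ^ a i * q x) f
    = (\<lambda>x. 2 ^ (a i + m) * fact (a i + m) * (dunkl_j Rp \<kappa> i ^^ a i) g x)"
    unfolding lap_comm_coord_power[OF q f] e dunkl_j_power_cmult[OF g] by (simp add: power_add fun_eq_iff)
  moreover have "\<exists>l. hpoly l ((dunkl_j Rp \<kappa> i ^^ a i) g)" using hpoly_dunkl_j_power[OF g] by blast
  ultimately show ?case by (simp add: m_def q_def g_def)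
qed

text \<open>The commutator expands into terms Lap^i (q Lap^(k-i) g). The integral of each is a
  multiple of that of q Lap^(k-i) g, which is 0 by orthogonality.\<close>

lemma sphere_int_lap_comm_low:
  assumes q: "hpoly m q" "Lap q = (\<lambda>x. 0)"
  shows "hpoly b g \<Longrightarrow> b < m \<Longrightarrow> sphere_int (lap_comm k q g) = 0"
proof (induction k arbitrary: b g)
  case 0
  then show ?case using sphere_int_harmonic_orthogonal[OF q 0] by (simp add: mult.commute)
next
  case (Suc k)
  note h = hpoly_lap_comm[OF q(1) Suc.prems(1), of k]
  have "sphere_int (lap_comm (Suc k) q g) = sphere_int (Lap (lap_comm k q g)) - sphere_int (lap_comm k q (Lap g))"
    using sphere_int_diff[OF hpoly_laplacian[OF h], of "lap_comm k q (Lap g)"] hpoly_lap_comm_lap[OF q(1) Suc.prems(1), of k]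
    by (simp add: diff_diff_left)
  also have "sphere_int (Lap (lap_comm k q g)) = 0"
    using sphere_int_laplacian[OF h] Suc.IH[OF Suc.prems] by simp
  also have "sphere_int (lap_comm k q (Lap g)) = 0"
    using Suc.IH[OF hpoly_laplacian[OF Suc.prems(1)]] Suc.prems(2) by simp
  finally show ?case by simp
qed

lemma sphere_int_lap_comm:
  assumes q: "hpoly m q" "Lap q = (\<lambda>x. 0)" and f: "hpoly m f"
  shows "k \<le> m \<Longrightarrow> fact (m - k) * pochhammer (lambda_kappa Rp \<kappa> + 1) (m - k) * sphere_int (lap_comm k q f)
    = 4 ^ k * fact m * pochhammer (lambda_kappa Rp \<kappa> + 1) m * sphere_int (\<lambda>x. q x * f x)"
proof (induction k)
  case (Suc k)
  define i where "i = m - Suc k"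
  have i: "m - k = Suc i" "m + m - 2 * k = 2 * Suc i" using Suc.prems by (auto simp: i_def)
  note h = hpoly_lap_comm[OF q(1) f, of k]
  have "sphere_int (lap_comm (Suc k) q f) = sphere_int (Lap (lap_comm k q f)) - sphere_int (lap_comm k q (Lap f))"
    using sphere_int_diff[OF hpoly_laplacian[OF h], of "lap_comm k q (Lap f)"] hpoly_lap_comm_lap[OF q(1) f, of k]
    by (simp add: diff_diff_left)
  \<comment> \<open>Here m > 0, so even the truncated degree m - 2 of \<open>Lap f\<close> lies
    below m.\<close>
  also have "sphere_int (lap_comm k q (Lap f)) = 0"
    using sphere_int_lap_comm_low[OF q hpoly_laplacian[OF f]] Suc.prems by simp
  also have "sphere_int (Lap (lap_comm k q f)) = (2 * real (Suc i)) * (2 * real (Suc i) + 2 * lambda_kappa Rp \<kappa>) * sphere_int (lap_comm k q f)"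
    unfolding sphere_int_laplacian[OF h] i lambda_kappa_hdim[symmetric] by simp
  finally have "fact i * pochhammer (lambda_kappa Rp \<kappa> + 1) i * sphere_int (lap_comm (Suc k) q f)
    = 4 * (fact (Suc i) * pochhammer (lambda_kappa Rp \<kappa> + 1) (Suc i) * sphere_int (lap_comm k q f))"
    by (simp add: pochhammer_Suc algebra_simps)
  also have "\<dots> = 4 * (4 ^ k * fact m * pochhammer (lambda_kappa Rp \<kappa> + 1) m * sphere_int (\<lambda>x. q x * f x))"
    using Suc.IH Suc.prems by (simp only: i[symmetric])
  finally show ?case by (simp only: i_def power_Suc mult.assoc)
qed simp

end

section \<open>From formal polynomials to polynomial functions\<close>

lemma monomial_list:
  fixes x :: "real^'n::{finite,linorder}" and a :: "'n \<Rightarrow> nat"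
  shows "(\<Prod>i\<in>UNIV. (x $ i) ^ a i) = (\<Prod>i\<leftarrow>sorted_list_of_set UNIV. (x $ i) ^ a i)"
    and "(\<Sum>i\<in>UNIV. a i) = (\<Sum>i\<leftarrow>sorted_list_of_set UNIV. a i)"
  using prod.distinct_set_conv_list[of "sorted_list_of_set (UNIV :: 'n set)" "\<lambda>i. (x $ i) ^ a i"]
    sum.distinct_set_conv_list[of "sorted_list_of_set (UNIV :: 'n set)" a] by simp_all

lemma hpoly_rpoly_eval:
  fixes P :: "'n::{finite,linorder} rpoly"
  assumes "P \<in> hom_polys l"
  shows "hpoly l (rpoly_eval P)"
  unfolding rpoly_eval_def[abs_def] monomial_list(1)
proof (intro hpoly_sum hpoly_cmult)
  fix a assume "a \<in> Poly_Mapping.keys P"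
  with assms have "l = (\<Sum>i\<leftarrow>sorted_list_of_set UNIV. Poly_Mapping.lookup a i)"
    by (auto simp: hom_polys_def monomial_list(2))
  then show "hpoly l (\<lambda>x. \<Prod>i\<leftarrow>sorted_list_of_set UNIV. (x $ i) ^ Poly_Mapping.lookup a i)"
    using hpoly_monomial_list by blast
qed

text \<open>All monomials of q have degree m and hence share the factor 2^m m!, so linearity in the
  multiplier suffices.\<close>

lemma lap_comm_rpoly_eval:
  fixes R Rp :: "(real^'n::{finite,linorder}) set"
  assumes "dunkl_setting R Rp \<kappa>" and q: "q \<in> hom_polys m" and f: "hpoly b f"
  shows "dunkl_setting.lap_comm Rp \<kappa> m (rpoly_eval q) f = (\<lambda>x. 2 ^ m * fact m * poly_dunkl Rp \<kappa> q f x)"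
proof -
  interpret dunkl_setting R Rp \<kappa> by fact
  let ?xs = "sorted_list_of_set (UNIV :: 'n set)"
  have deg: "m = (\<Sum>i\<leftarrow>?xs. Poly_Mapping.lookup a i)" if "a \<in> Poly_Mapping.keys q" for a
    using q that by (auto simp: hom_polys_def monomial_list(2))
  have h: "hpoly m (\<lambda>x. \<Prod>i\<leftarrow>?xs. (x $ i) ^ Poly_Mapping.lookup a i)" if "a \<in> Poly_Mapping.keys q" for a
    unfolding deg[OF that] by (rule hpoly_monomial_list)
  have "lap_comm m (rpoly_eval q) f = (\<lambda>x. \<Sum>a\<in>Poly_Mapping.keys q.
      lap_comm m (\<lambda>x. Poly_Mapping.lookup q a * (\<Prod>i\<leftarrow>?xs. (x $ i) ^ Poly_Mapping.lookup a i)) f x)"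
    unfolding rpoly_eval_def[abs_def] monomial_list(1)
    by (rule lap_comm_sum[OF hpoly_cmult[OF h] f])
  also have "\<dots> = (\<lambda>x. \<Sum>a\<in>Poly_Mapping.keys q. Poly_Mapping.lookup q a * (2 ^ m * fact m * dunkl_mono Rp \<kappa> a f x))"
  proof (intro ext sum.cong HOL.refl)
    fix a x assume a: "a \<in> Poly_Mapping.keys q"
    have "lap_comm m (\<lambda>x. \<Prod>i\<leftarrow>?xs. (x $ i) ^ Poly_Mapping.lookup a i) f = (\<lambda>x. 2 ^ m * fact m * dunkl_mono Rp \<kappa> a f x)"
      using lap_comm_monomial[OF f, of "Poly_Mapping.lookup a" ?xs] unfolding deg[OF a, symmetric] dunkl_mono_def by blast
    then show "lap_comm m (\<lambda>x. Poly_Mapping.lookup q a * (\<Prod>i\<leftarrow>?xs. (x $ i) ^ Poly_Mapping.lookup a i)) f x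
      = Poly_Mapping.lookup q a * (2 ^ m * fact m * dunkl_mono Rp \<kappa> a f x)"
      unfolding lap_comm_cmult[OF h[OF a] f] by simp
  qed
  also have "\<dots> = (\<lambda>x. 2 ^ m * fact m * poly_dunkl Rp \<kappa> q f x)"
    by (simp add: poly_dunkl_def sum_distrib_left mult_ac)
  finally show ?thesis .
qed

theorem theorem3p1:
  fixes R Rp :: "(real^('n::{finite,linorder})) set"
    and \<kappa> :: "real^('n::{finite,linorder}) \<Rightarrow> real"
    and p q :: "('n::{finite,linorder}) rpoly" and l m :: nat
  assumes "root_system R" and "positive_system R Rp" and "multiplicity R \<kappa>"
    and "p \<in> hom_polys l" and "q \<in> dunkl_harmonics Rp \<kappa> m"
  shows "(\<forall>n::nat. l = m + 2 * n \<longrightarrow>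
            (\<forall>x. (1 / omega_kappa Rp \<kappa>) *
                   integral\<^sup>L sphere_measure
                     (\<lambda>y. rpoly_eval q y * rpoly_eval p y * (h_kappa Rp \<kappa> y)\<^sup>2)
                 = 1 / (2 ^ (m + 2 * n) * fact n * pochhammer (lambda_kappa Rp \<kappa> + 1) (m + n))
                   * poly_dunkl Rp \<kappa> q ((dunkl_laplacian Rp \<kappa> ^^ n) (rpoly_eval p)) x))
       \<and> ((l < m \<or> odd (int l - int m)) \<longrightarrow>
            integral\<^sup>L sphere_measure
              (\<lambda>y. rpoly_eval q y * rpoly_eval p y * (h_kappa Rp \<kappa> y)\<^sup>2) = 0)"
proof -
  interpret dunkl_setting R Rp \<kappa> by unfold_locales fact+
  let ?p = "rpoly_eval p" and ?q = "rpoly_eval q" and ?lam = "lambda_kappa Rp \<kappa>"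
  have qm: "q \<in> hom_polys m" and harm: "Lap ?q = (\<lambda>x. 0)"
    using assms(5) by (auto simp: dunkl_harmonics_def)
  have p: "hpoly l ?p" and q: "hpoly m ?q"
    using hpoly_rpoly_eval assms(4) qm by auto
  have S: "integral\<^sup>L sphere_measure (\<lambda>y. ?q y * ?p y * (h_kappa Rp \<kappa> y)\<^sup>2) = sphere_int (\<lambda>x. ?q x * ?p x)"
    by (simp add: sphere_int_def weight_def)
  have om: "omega_kappa Rp \<kappa> = sphere_int (\<lambda>x. 1)" by (simp add: omega_kappa_def sphere_int_def weight_def)
  have "1 / sphere_int (\<lambda>x. 1) * sphere_int (\<lambda>x. ?q x * ?p x)
    = 1 / (2 ^ (m + 2 * n) * fact n * pochhammer (?lam + 1) (m + n)) * poly_dunkl Rp \<kappa> q ((Lap ^^ n) ?p) x"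
    if n: "l = m + 2 * n" for n x
  proof -
    let ?f = "(Lap ^^ n) ?p"
    have f: "hpoly m ?f" using hpoly_laplacian_power p n by blast
    \<comment> \<open>All degrees are used up, m + m - 2 m = 0, so the commutator is a constant and
      its integral is that constant times omega.\<close>
    have "hpoly 0 (lap_comm m ?q ?f)" using hpoly_lap_comm[OF q f, of m] by simp
    then obtain c where c: "lap_comm m ?q ?f = (\<lambda>x. c)" by (rule hpoly_0E)
    have "sphere_int (\<lambda>x. c) = c * sphere_int (\<lambda>x. 1)" using sphere_int_cmult[of c "\<lambda>x. 1"] by simp
    moreover have "c = 2 ^ m * fact m * poly_dunkl Rp \<kappa> q ?f x"
      using lap_comm_rpoly_eval[OF dunkl_setting_axioms qm f] c by metis
    ultimately have "2 ^ m * fact m * poly_dunkl Rp \<kappa> q ?f x * sphere_int (\<lambda>x. 1) = 4 ^ m * fact m * pochhammer (?lam + 1) m * sphere_int (\<lambda>x. ?q x * ?f x)"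
      using sphere_int_lap_comm[OF q harm f, of m] c by simp
    \<comment> \<open>One factor 2^m and m! cancel against the normalisation of the
      commutator.\<close>
    moreover have "(4::real) ^ m = 2 ^ m * 2 ^ m" by (simp flip: power_mult_distrib)
    ultimately have 1: "poly_dunkl Rp \<kappa> q ?f x * sphere_int (\<lambda>x. 1) = 2 ^ m * pochhammer (?lam + 1) m * sphere_int (\<lambda>x. ?q x * ?f x)"
      by simp
    have 2: "sphere_int (\<lambda>x. ?q x * ?f x) = 4 ^ n * fact n * pochhammer (?lam + 1 + real m) n * sphere_int (\<lambda>x. ?q x * ?p x)"
      using sphere_int_laplacian_power[OF q harm, of n ?p] p n by (simp add: mult.commute[of "?q _"])
    have "?lam + 1 > 0" using lambda_kappa_hdim hdim_ge_1 by linarith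
    then have pos: "pochhammer (?lam + 1) (m + n) > 0" by (rule pochhammer_pos)
    have "poly_dunkl Rp \<kappa> q ?f x * sphere_int (\<lambda>x. 1)
      = 2 ^ (m + 2 * n) * fact n * pochhammer (?lam + 1) (m + n) * sphere_int (\<lambda>x. ?q x * ?p x)"
      \<comment> \<open>The symbols (lambda + 1)_m and (lambda + 1 + m)_n combine, and 2^m 4^n
        becomes 2^(m + 2 n).\<close>
      unfolding 1 2 pochhammer_product'[of "?lam + 1" m n] by (simp add: power_add power_mult)
    then show ?thesis using sphere_int_one_neq_0 pos by (simp add: field_simps)
  qed
  moreover have "sphere_int (\<lambda>x. ?q x * ?p x) = 0" if "l < m \<or> odd (int l - int m)"
    using that
  proof
    assume "l < m"
    then show ?thesis using sphere_int_harmonic_orthogonal[OF q harm p] by (simp add: mult.commute)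
  next
    assume "odd (int l - int m)"
    then have "odd (m + l)" by presburger
    then show ?thesis by (rule sphere_int_odd[OF hpoly_mult[OF q p]])
  qed
  ultimately show ?thesis unfolding S om by blast
qed

end
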